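(* Let $m\ge 2$, let $L$ be an $m$-component framed oriented link in $S^3$ (with components numbered $1,\dots,m$), let $1\le i<j\le m$ and let $n\ge1$ be an integer. Then $$\frac{1}{n!}\,\ell_{ij}(L)^n=\sum_{D\in\mathcal{M}^{ij}_n(m)}C_L[D],$$ where $\ell_{ij}(L)$ is the linking number of the $i$th and $j$th components of $L$, $\mathcal{M}^{ij}_n(m)$ is the set of all degree $n$ chord diagrams on $m$ circles whose $n$ chords are all of type $(i,j)$, and $C_L[D]$ denotes the coefficient of the chord diagram $D$ in the framed Kontsevich integral $Z(L)$.
   Context: Chord diagrams. A chord diagram on $m$ circles is a collection of finitely many chords (copies of the unit interval) whose endpoints are pairwise distinct points on the disjoint union of $m$ oriented circles numbered $1,\dots,m$, considered up to orientation-preserving homeomorphism preserving each circle. Its degree is its number of chords. A type $(i,j)$ chord is a chord whose endpoints sit on circles $i$ and $j$. $\mathcal{A}(m)$ is the $\mathbb{Q}$-vector space (completed by degree) generated by chord diagrams on $m$ circles modulo the 4T relation: for any three disjoint oriented arcs $p,q,r$ of the circles, $t_{pq}t_{pr}-t_{pr}t_{pq}+t_{pq}t_{qr}-t_{qr}t_{pq}=0$, where $t_{xy}t_{zw}$ denotes a diagram having, on these arcs, a chord joining $x,y$ and a chord joining $z,w$, stacked in the given order along the orientation, the four diagrams being identical elsewhere. The same definitions apply to diagrams on any oriented 1-manifold. Coefficients. $C[D](A)$ denotes the coefficient of $D$ in $A\in\mathcal{A}(m)$, and $C_L[D]:=C[D](Z(L))$. An individual coefficient is in general not well defined because of the 4T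 relation; a sum $\sum_{D\in\mathcal{D}}C[D]$ is understood as the linear functional sending a chord diagram to $1$ if it lies in $\mathcal{D}$ and to $0$ otherwise, evaluated on any representative; it is well defined on $\mathcal{A}(m)$ when it vanishes on all 4T relators, which is the case for $\mathcal{D}=\mathcal{M}^{ij}_n(m)$. Framed Kontsevich integral $Z$ (Le–Murakami). A framed q-tangle is a framed oriented tangle with a parenthesization on both sets of boundary points; each decomposes, under composition and juxtaposition, into elementary q-tangles: $I$ (trivial strand), $X_\pm$ (positive/negative crossing of two upward strands), $C_\pm$ (cap and cup), $\Lambda_\pm$ (change of parenthesization of trivial strands), and those obtained by reversing orientations of components. $Z$ is the multiplicative invariant with values in spaces of chord diagrams on the underlying 1-manifolds determined by: $Z(I)$ is the strand without chords; $Z(X_\pm)=\sum_{k\ge0}\frac{(\pm1)^k}{2^kk!}X_k$, where $X_k$ consists of the two crossing strands joined by $k$ parallel chords; $Z(C_\pm)=\sqrt{\nu}$; $Z(\Lambda_\pm)=\Phi^{\pm1}$ with $\Phi$ a Drinfeld associator (with the usual cabling of strands; the value on links is independent of its choice). Reversing the orientation of a strand reverses it in the diagrams and multiplies by $(-1)^{\#\text{chord endpoints on it}}$. Here $\nu=Z(U_0)\in\mathcal{A}(1)$ is the value on the $0$-framed unknot, $\nu=\chi\big(\exp_\sqcup(\sum_{n\ge1}b_{2n}W_{2n})\big)$, where $W_{2n}$ is the wheel with $2n$ univalent vertices, $b_{2n}$ is the coefficient of $x^{2n}$ in $\frac12\ln\frac{\sinh(x/2)}{x/2}$, $\exp_\sqcup$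 is the exponential for disjoint union, and $\chi$ averages over all ways of attaching univalent vertices to the circle and then recursively applies the STU relation (a trivalent vertex adjacent to the circle is the difference of the two ways of attaching its two other legs directly to the circle) to obtain chord diagrams. *)

theory Defs
  imports
    "HOL-Library.Multiset"
    "HOL-Library.Poly_Mapping"
    "HOL-Computational_Algebra.Formal_Power_Series"
    "HOL-Combinatorics.Multiset_Permutations"
begin

section \<open>Graded formal sums\<close>

text \<open>An element of a completed graded vector space with basis \<open>'a\<close>: its degree \<open>d\<close> part is a
  finite rational combination of basis elements.\<close>

type_synonym 'a series = "nat \<Rightarrow> ('a \<Rightarrow>\<^sub>0 rat)"

definition scale :: "rat \<Rightarrow> ('a \<Rightarrow>\<^sub>0 rat) \<Rightarrow> ('a \<Rightarrow>\<^sub>0 rat)" where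
  "scale c f = Poly_Mapping.map ((*) c) f"

text \<open>The bilinear extension of an operation on basis elements that adds degrees.\<close>

definition sprod :: "('a \<Rightarrow> 'b \<Rightarrow> 'c) \<Rightarrow> 'a series \<Rightarrow> 'b series \<Rightarrow> 'c series" where
  "sprod mul F G d =
     (\<Sum>i\<le>d. \<Sum>x\<in>Poly_Mapping.keys (F i). \<Sum>y\<in>Poly_Mapping.keys (G (d - i)).
        Poly_Mapping.single (mul x y)
          (Poly_Mapping.lookup (F i) x * Poly_Mapping.lookup (G (d - i)) y))"

definition sone :: "'a \<Rightarrow> 'a series" where
  "sone e d = (if d = 0 then Poly_Mapping.single e 1 else 0)"


section \<open>Chord diagrams on oriented 1-manifolds\<close>

text \<open>A component of the 1-manifold is an oriented arc (with its source and target boundary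
  points) or a circle, and carries a number (its colour).  A boundary point \<open>(h, k)\<close> is the
  \<open>k\<close>-th point, counted from the left and from 0, at level \<open>h\<close>; the bottom of a tangle has level 0
  and its top level 1.\<close>

type_synonym point = "nat \<times> nat"

datatype component = Arc point point nat | Circle nat

fun colour :: "component \<Rightarrow> nat" where
  "colour (Arc p q c) = c"
| "colour (Circle c) = c"

text \<open>A chord diagram is a Gauss code: each component comes with the list of the chord endpoints
  met when travelling along its orientation, an endpoint being given by the name of its chord.
  For a circle the list starts at an arbitrary base point.\<close>

type_synonym 'l code = "(component \<times> 'l list) list"

type_synonym diagram = "nat code"

definition letters :: "'l code \<Rightarrow> 'l list" where
  "letters D = concat (map snd D)"

definition is_diagram :: "diagram \<Rightarrow> bool" where
  "is_diagram D \<longleftrightarrow> (\<forall>x\<in>set (letters D). count_list (letters D) x = 2)"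

definition degree :: "diagram \<Rightarrow> nat" where
  "degree D = card (set (letters D))"

definition map_words :: "('l list \<Rightarrow> 'k list) \<Rightarrow> 'l code \<Rightarrow> 'k code" where
  "map_words g D = map (\<lambda>(s, w). (s, g w)) D"

fun same_up_to_base_point :: "component \<times> 'l list \<Rightarrow> component \<times> 'l list \<Rightarrow> bool" where
  "same_up_to_base_point (Arc p q c, v) (s, w) \<longleftrightarrow> s = Arc p q c \<and> w = v"
| "same_up_to_base_point (Circle c, v) (s, w) \<longleftrightarrow> s = Circle c \<and> (\<exists>r. w = rotate r v)"

text \<open>Orientation-preserving homeomorphism preserving each component: chords are renamed, the
  components may be listed in another order, and base points of circles are moved.\<close>

definition diagram_iso :: "diagram \<Rightarrow> diagram \<Rightarrow> bool" where
  "diagram_iso D E \<longleftrightarrow>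
     (\<exists>f D'. inj_on f (set (letters D)) \<and> mset D' = mset (map_words (map f) D) \<and>
        list_all2 same_up_to_base_point D' E)"


section \<open>The 4T relation\<close>

text \<open>The three disjoint arcs p, q, r are marked by slots in a code; \<open>fill\<close> puts the endpoints of
  the two new chords 0 and 1 into the slots.\<close>

datatype slot = Old nat | SlotP | SlotQ | SlotR

fun fill_slot :: "nat list \<Rightarrow> nat list \<Rightarrow> nat list \<Rightarrow> slot \<Rightarrow> nat list" where
  "fill_slot ps qs rs (Old x) = [x + 2]"
| "fill_slot ps qs rs SlotP = ps"
| "fill_slot ps qs rs SlotQ = qs"
| "fill_slot ps qs rs SlotR = rs"

definition fill :: "nat list \<Rightarrow> nat list \<Rightarrow> nat list \<Rightarrow> slot code \<Rightarrow> diagram" where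
  "fill ps qs rs T = map_words (\<lambda>w. concat (map (fill_slot ps qs rs) w)) T"

definition is_template :: "slot code \<Rightarrow> bool" where
  "is_template T \<longleftrightarrow>
     count_list (letters T) SlotP = 1 \<and> count_list (letters T) SlotQ = 1 \<and>
     count_list (letters T) SlotR = 1 \<and>
     (\<forall>x. Old x \<in> set (letters T) \<longrightarrow> count_list (letters T) (Old x) = 2)"

text \<open>\<open>t\<^sub>p\<^sub>q t\<^sub>p\<^sub>r - t\<^sub>p\<^sub>r t\<^sub>p\<^sub>q + t\<^sub>p\<^sub>q t\<^sub>q\<^sub>r - t\<^sub>q\<^sub>r t\<^sub>p\<^sub>q\<close>, where chord 0 is pq.\<close>

definition four_T :: "slot code \<Rightarrow> (diagram \<Rightarrow>\<^sub>0 rat)" where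
  "four_T T =
     Poly_Mapping.single (fill [0, 1] [0] [1] T) 1 - Poly_Mapping.single (fill [1, 0] [0] [1] T) 1
   + Poly_Mapping.single (fill [0] [0, 1] [1] T) 1 - Poly_Mapping.single (fill [0] [1, 0] [1] T) 1"

text \<open>The linear span of the 4T relators and of the differences of isomorphic codes.\<close>

inductive_set relations :: "(diagram \<Rightarrow>\<^sub>0 rat) set" where
  zero: "0 \<in> relations"
| iso: "a \<in> relations \<Longrightarrow> is_diagram D \<Longrightarrow> diagram_iso D E \<Longrightarrow>
    a + scale c (Poly_Mapping.single D 1 - Poly_Mapping.single E 1) \<in> relations"
| four_T: "a \<in> relations \<Longrightarrow> is_template T \<Longrightarrow> a + scale c (four_T T) \<in> relations"

text \<open>Equality of the classes of two formal sums of diagrams in the degree-completed space of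
  chord diagrams modulo 4T.\<close>

definition equal_mod_4T :: "diagram series \<Rightarrow> diagram series \<Rightarrow> bool" where
  "equal_mod_4T A B \<longleftrightarrow> (\<forall>d. A d - B d \<in> relations)"


section \<open>Chord diagrams on numbered circles and their coefficients\<close>

definition codes_on_circles :: "nat \<Rightarrow> diagram set" where
  "codes_on_circles m = {D. is_diagram D \<and> mset (map fst D) = mset (map Circle [1..<Suc m])}"

definition chord_diagrams :: "nat \<Rightarrow> diagram set set" where
  "chord_diagrams m = codes_on_circles m // {(D, E). diagram_iso D E}"

definition class_degree :: "diagram set \<Rightarrow> nat" where
  "class_degree K = the_elem (degree ` K)"

text \<open>\<open>C[K](A)\<close> for a chord diagram \<open>K\<close> (a class of codes) and a representative \<open>A\<close>.\<close>

definition coefficient :: "diagram set \<Rightarrow> diagram series \<Rightarrow> rat" where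
  "coefficient K A =
     (\<Sum>D\<in>K \<inter> Poly_Mapping.keys (A (class_degree K)). Poly_Mapping.lookup (A (class_degree K)) D)"

text \<open>The multiset of the numbers of the two circles on which the endpoints of chord \<open>x\<close> sit.\<close>

definition chord_type :: "diagram \<Rightarrow> nat \<Rightarrow> nat multiset" where
  "chord_type D x = mset (concat (map (\<lambda>(s, w). replicate (count_list w x) (colour s)) D))"

definition mixed_diagrams :: "nat \<Rightarrow> nat \<Rightarrow> nat \<Rightarrow> nat \<Rightarrow> diagram set set" where
  "mixed_diagrams m i j n =
     {K \<in> chord_diagrams m. class_degree K = n \<and>
        (\<forall>D\<in>K. \<forall>x\<in>set (letters D). chord_type D x = {#i, j#})}"


section \<open>Composition and juxtaposition of diagrams\<close>

text \<open>Names of chords are kept apart by doubling them.\<close>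

definition left_names :: "nat list \<Rightarrow> nat list" where
  "left_names w = map (\<lambda>x. 2 * x) w"

definition right_names :: "nat list \<Rightarrow> nat list" where
  "right_names w = map (\<lambda>x. 2 * x + 1) w"

fun map_points :: "(point \<Rightarrow> point) \<Rightarrow> component \<Rightarrow> component" where
  "map_points g (Arc p q c) = Arc (g p) (g q) c"
| "map_points g (Circle c) = Circle c"

definition move :: "(point \<Rightarrow> point) \<Rightarrow> diagram \<Rightarrow> diagram" where
  "move g D = map (\<lambda>(s, w). (map_points g s, w)) D"

fun ends_at :: "point \<Rightarrow> component \<Rightarrow> bool" where
  "ends_at p (Arc a b c) \<longleftrightarrow> b = p"
| "ends_at p (Circle c) \<longleftrightarrow> False"

fun starts_at :: "point \<Rightarrow> component \<Rightarrow> bool" where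
  "starts_at p (Arc a b c) \<longleftrightarrow> a = p"
| "starts_at p (Circle c) \<longleftrightarrow> False"

text \<open>Glue the arc ending at \<open>p\<close> to the arc starting at \<open>p\<close>; if they are the same arc, it closes up
  to a circle.\<close>

definition join :: "point \<Rightarrow> diagram \<Rightarrow> diagram" where
  "join p D =
     (case (filter (\<lambda>(s, w). ends_at p s) D, filter (\<lambda>(s, w). starts_at p s) D) of
        ([(Arc a b c, v)], [(Arc a' b' c', w)]) \<Rightarrow>
          (if a = p then (Circle c, v) else (Arc a b' c, v @ w))
            # filter (\<lambda>(s, w). \<not> ends_at p s \<and> \<not> starts_at p s) D
      | _ \<Rightarrow> D)"

text \<open>\<open>E\<close> is put on top of \<open>D\<close>, along \<open>k\<close> boundary points.\<close>

definition compose :: "nat \<Rightarrow> diagram \<Rightarrow> diagram \<Rightarrow> diagram" where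
  "compose k D E =
     move (\<lambda>(h, x). (if h = 0 then 0 else 1, x))
       (fold join (map (\<lambda>x. (1, x)) [0..<k])
          (map_words left_names D @ move (\<lambda>(h, x). (h + 1, x)) (map_words right_names E)))"

text \<open>\<open>E\<close> is put to the right of \<open>D\<close>, which has \<open>b\<close> bottom and \<open>t\<close> top boundary points.\<close>

definition juxtapose :: "nat \<Rightarrow> nat \<Rightarrow> diagram \<Rightarrow> diagram \<Rightarrow> diagram" where
  "juxtapose b t D E =
     map_words left_names D
       @ move (\<lambda>(h, x). (h, if h = 0 then b + x else t + x)) (map_words right_names E)"


section \<open>q-tangles\<close>

text \<open>A strand at a boundary point: the number of the component it belongs to, and whether it
  points upward.\<close>

type_synonym strand = "nat \<times> bool"

datatype pword = Point strand | Pair pword pword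

text \<open>A parenthesized set of boundary points; \<open>None\<close> is the empty one.\<close>

type_synonym boundary = "pword option"

fun points :: "pword \<Rightarrow> strand list" where
  "points (Point x) = [x]"
| "points (Pair u v) = points u @ points v"

definition width :: "boundary \<Rightarrow> nat" where
  "width b = (case b of None \<Rightarrow> 0 | Some u \<Rightarrow> length (points u))"

fun juxt_boundary :: "boundary \<Rightarrow> boundary \<Rightarrow> boundary" where
  "juxt_boundary None b = b"
| "juxt_boundary a None = a"
| "juxt_boundary (Some u) (Some v) = Some (Pair u v)"

text \<open>Elementary q-tangles with blackboard framing, for all orientations of their strands:
  \<^item> \<open>Crossing e x y\<close>: \<open>x\<close> goes from the bottom left to the top right, \<open>y\<close> from the bottom right to
    the top left; \<open>e\<close> tells whether the crossing is positive when both strands are directed upward.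
  \<^item> \<open>Cap (c, u)\<close> and \<open>Cup (c, u)\<close>: \<open>u\<close> tells whether the left leg points upward.
  \<^item> \<open>Reparenthesize e u v w\<close> goes from \<open>(u v) w\<close> to \<open>u (v w)\<close> if \<open>e\<close> holds, and back otherwise.
  \<open>Compose s t\<close> is \<open>t\<close> on top of \<open>s\<close>.\<close>

datatype qtangle =
    Strand strand
  | Crossing bool strand strand
  | Cap strand
  | Cup strand
  | Reparenthesize bool pword pword pword
  | Compose qtangle qtangle
  | Juxtapose qtangle qtangle

fun opposite :: "strand \<Rightarrow> strand" where
  "opposite (c, u) = (c, \<not> u)"

fun bottom :: "qtangle \<Rightarrow> boundary" and top :: "qtangle \<Rightarrow> boundary" where
  "bottom (Strand x) = Some (Point x)"
| "top (Strand x) = Some (Point x)"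
| "bottom (Crossing e x y) = Some (Pair (Point x) (Point y))"
| "top (Crossing e x y) = Some (Pair (Point y) (Point x))"
| "bottom (Cap x) = Some (Pair (Point x) (Point (opposite x)))"
| "top (Cap x) = None"
| "bottom (Cup x) = None"
| "top (Cup x) = Some (Pair (Point x) (Point (opposite x)))"
| "bottom (Reparenthesize e u v w) =
     Some (if e then Pair (Pair u v) w else Pair u (Pair v w))"
| "top (Reparenthesize e u v w) =
     Some (if e then Pair u (Pair v w) else Pair (Pair u v) w)"
| "bottom (Compose s t) = bottom s"
| "top (Compose s t) = top t"
| "bottom (Juxtapose s t) = juxt_boundary (bottom s) (bottom t)"
| "top (Juxtapose s t) = juxt_boundary (top s) (top t)"

fun well_formed :: "qtangle \<Rightarrow> bool" where
  "well_formed (Compose s t) \<longleftrightarrow> well_formed s \<and> well_formed t \<and> top s = bottom t"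
| "well_formed (Juxtapose s t) \<longleftrightarrow> well_formed s \<and> well_formed t"
| "well_formed _ \<longleftrightarrow> True"

definition orientation_sign :: "strand \<Rightarrow> rat" where
  "orientation_sign x = (if snd x then 1 else -1)"

text \<open>The arc of a strand drawn from \<open>p\<close> to \<open>q\<close>, with the endpoints \<open>w\<close> met from \<open>p\<close> to \<open>q\<close>;
  it is oriented from \<open>p\<close> to \<open>q\<close> iff \<open>forward\<close>.\<close>

definition arc :: "bool \<Rightarrow> point \<Rightarrow> point \<Rightarrow> nat \<Rightarrow> 'l list \<Rightarrow> component \<times> 'l list" where
  "arc forward p q c w = (if forward then (Arc p q c, w) else (Arc q p c, rev w))"

definition crossing_diagram :: "strand \<Rightarrow> strand \<Rightarrow> nat list \<Rightarrow> diagram" where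
  "crossing_diagram x y w =
     [arc (snd x) (0, 0) (1, 1) (fst x) w, arc (snd y) (0, 1) (1, 0) (fst y) w]"

definition cap_diagram :: "strand \<Rightarrow> nat list \<Rightarrow> diagram" where
  "cap_diagram x w = [arc (snd x) (0, 0) (0, 1) (fst x) w]"

definition cup_diagram :: "strand \<Rightarrow> nat list \<Rightarrow> diagram" where
  "cup_diagram x w = [arc (\<not> snd x) (1, 0) (1, 1) (fst x) w]"

text \<open>Vertical strands with horizontal chords, listed from bottom to top; a pair \<open>(p, q)\<close> is the
  chord \<open>t\<^sub>p\<^sub>q\<close> joining the strands in positions \<open>p\<close> and \<open>q\<close>.\<close>

definition horizontal_diagram :: "strand list \<Rightarrow> (nat \<times> nat) list \<Rightarrow> diagram" where
  "horizontal_diagram xs cs =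
     map (\<lambda>k. arc (snd (xs ! k)) (0, k) (1, k) (fst (xs ! k))
                (filter (\<lambda>l. k = fst (cs ! l) \<or> k = snd (cs ! l)) [0..<length cs]))
       [0..<length xs]"

text \<open>The underlying 1-manifold, as a diagram without chords.\<close>

fun skeleton :: "qtangle \<Rightarrow> diagram" where
  "skeleton (Strand x) = horizontal_diagram [x] []"
| "skeleton (Crossing e x y) = crossing_diagram x y []"
| "skeleton (Cap x) = cap_diagram x []"
| "skeleton (Cup x) = cup_diagram x []"
| "skeleton (Reparenthesize e u v w) = horizontal_diagram (points u @ points v @ points w) []"
| "skeleton (Compose s t) = compose (width (top s)) (skeleton s) (skeleton t)"
| "skeleton (Juxtapose s t) =
     juxtapose (width (bottom s)) (width (top s)) (skeleton s) (skeleton t)"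

text \<open>A closed q-tangle presenting an \<open>m\<close>-component framed oriented link, whose components are
  numbered \<open>1, \<dots>, m\<close>.\<close>

definition presents_link :: "nat \<Rightarrow> qtangle \<Rightarrow> bool" where
  "presents_link m t \<longleftrightarrow> well_formed t \<and> bottom t = None \<and> top t = None \<and>
     mset (map fst (skeleton t)) = mset (map Circle [1..<Suc m])"

text \<open>Sum of the signs of the crossings between components \<open>i\<close> and \<open>j\<close>.  Reversing one strand of
  a crossing changes its sign.\<close>

fun crossing_sum :: "nat \<Rightarrow> nat \<Rightarrow> qtangle \<Rightarrow> rat" where
  "crossing_sum i j (Crossing e x y) =
     (if {#fst x, fst y#} = {#i, j#}
      then (if e then 1 else -1) * orientation_sign x * orientation_sign y else 0)"
| "crossing_sum i j (Compose s t) = crossing_sum i j s + crossing_sum i j t"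
| "crossing_sum i j (Juxtapose s t) = crossing_sum i j s + crossing_sum i j t"
| "crossing_sum i j _ = 0"

definition linking_number :: "nat \<Rightarrow> nat \<Rightarrow> qtangle \<Rightarrow> rat" where
  "linking_number i j t = crossing_sum i j t / 2"


section \<open>The element \<open>\<nu>\<close> and its square root\<close>

text \<open>A uni-trivalent graph attached to an oriented line: the list of edges met along the line,
  and the trivalent vertices, each given by its three edges in their cyclic order.\<close>

type_synonym vertex = "nat \<times> nat \<times> nat"

fun at_vertex :: "nat \<Rightarrow> vertex \<Rightarrow> bool" where
  "at_vertex x (a, b, c) \<longleftrightarrow> x = a \<or> x = b \<or> x = c"

fun other_edges :: "nat \<Rightarrow> vertex \<Rightarrow> nat \<times> nat" where
  "other_edges x (a, b, c) = (if x = a then (b, c) else if x = b then (c, a) else (a, b))"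

text \<open>STU is applied at the first vertex met along the line, until none of the \<open>k\<close> vertices is
  left.  With vertices oriented counterclockwise, the edges following the attached one are, in
  this order, the right one and the left one.\<close>

primrec resolve :: "nat \<Rightarrow> nat list \<Rightarrow> vertex list \<Rightarrow> (nat list \<Rightarrow>\<^sub>0 rat)" where
  "resolve 0 w vs = Poly_Mapping.single w 1"
| "resolve (Suc k) w vs =
     (let x = hd (filter (\<lambda>x. \<exists>v\<in>set vs. at_vertex x v) w);
          v = hd (filter (at_vertex x) vs);
          vs' = remove1 v vs;
          (r, l) = other_edges x v;
          before = takeWhile (\<lambda>y. y \<noteq> x) w;
          after = tl (dropWhile (\<lambda>y. y \<noteq> x) w)
      in resolve k (before @ [l, r] @ after) vs' - resolve k (before @ [r, l] @ after) vs')"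

text \<open>Vertices of the disjoint union of the wheels \<open>W\<^bsub>2n\<^esub>\<close> for \<open>n\<close> in a list; the legs are numbered
  from \<open>s\<close>, and the leg number \<open>k\<close> of a wheel is preceded by the edge number \<open>N + k\<close> of its rim.\<close>

fun wheels :: "nat \<Rightarrow> nat \<Rightarrow> nat list \<Rightarrow> vertex list" where
  "wheels N s [] = []"
| "wheels N s (n # ns) =
     map (\<lambda>k. (s + k, N + s + k, N + s + (k + 1) mod (2 * n))) [0..<2 * n]
       @ wheels N (s + 2 * n) ns"

text \<open>\<open>b\<^bsub>2n\<^esub>\<close>; the quotient is \<open>sinh (x/2) / (x/2)\<close>.\<close>

definition wheel_coeff :: "nat \<Rightarrow> rat" where
  "wheel_coeff n =
     fps_nth (fps_const (1/2) *
       fps_compose (fps_ln 1) ((fps_exp (1/2) - fps_exp (- 1/2)) / fps_X - 1)) (2 * n)"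

text \<open>\<open>\<nu>\<close>, with the circle cut open at a point (chord diagrams on a line and on a circle agree
  modulo 4T); a line diagram is given by its word.  The sum over lists \<open>ns\<close> expands
  \<open>exp\<^sub>\<squnion>\<close>; all \<open>d\<close> legs are attached to the line in all orders.\<close>

definition nu :: "nat list series" where
  "nu d =
     (\<Sum>ns\<in>{ns. 0 \<notin> set ns \<and> 2 * sum_list ns = d}.
        scale ((\<Prod>n\<leftarrow>ns. wheel_coeff n) / fact (length ns))
          (scale (1 / fact d)
            (\<Sum>w\<in>permutations_of_set {..<d}. resolve d w (wheels d 0 ns))))"

definition line_mult :: "nat list \<Rightarrow> nat list \<Rightarrow> nat list" where
  "line_mult v w = left_names v @ right_names w"

fun line_power :: "nat list series \<Rightarrow> nat \<Rightarrow> nat list series" where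
  "line_power F 0 = sone []"
| "line_power F (Suc k) = sprod line_mult F (line_power F k)"

text \<open>The binomial series; \<open>\<nu> - 1\<close> has no part of degree 0, so that powers beyond the \<open>d\<close>-th do not
  contribute to degree \<open>d\<close>.\<close>

definition sqrt_nu :: "nat list series" where
  "sqrt_nu d = (\<Sum>k\<le>d. scale ((1/2) gchoose k) (line_power (\<lambda>e. nu e - sone [] e) k d))"


section \<open>Drinfeld associators\<close>

text \<open>A noncommutative power series \<open>\<Phi>(A, B)\<close> is given by its coefficients; in a word, \<open>False\<close>
  stands for \<open>A\<close> and \<open>True\<close> for \<open>B\<close>.  It is group-like for the coproduct in which \<open>A\<close> and \<open>B\<close> are
  primitive: the coefficient of \<open>u \<otimes> v\<close> in the coproduct of a word \<open>w\<close> is the number of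
  sets of positions at which \<open>u\<close> can be read in \<open>w\<close>, while \<open>v\<close> is read at the others.\<close>

type_synonym nc_series = "bool list \<Rightarrow> rat"

definition group_like :: "nc_series \<Rightarrow> bool" where
  "group_like \<phi> \<longleftrightarrow> \<phi> [] = 1 \<and>
     (\<forall>u v. \<phi> u * \<phi> v =
        (\<Sum>w\<in>{w. length w = length u + length v}.
           \<phi> w * of_nat (card {S. S \<subseteq> {..<length w} \<and> nths w S = u \<and> nths w (- S) = v})))"

text \<open>The inverse of a series with constant term 1.\<close>

function nc_inverse :: "nc_series \<Rightarrow> nc_series" where
  "nc_inverse \<phi> w =
     (if w = [] then 1
      else - (\<Sum>k\<in>{1..length w}. \<phi> (take k w) * nc_inverse \<phi> (drop k w)))"
  by auto
termination by (relation "measure (\<lambda>(\<phi>, w). length w)") auto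

text \<open>\<open>\<Phi>(\<Sum> t\<^sub>p\<^sub>q, \<Sum> t\<^sub>q\<^sub>r)\<close> for \<open>p\<close>, \<open>q\<close>, \<open>r\<close> ranging over the disjoint sets \<open>U\<close>, \<open>V\<close>, \<open>W\<close> of strand
  positions, i.e. \<open>\<Phi>\<close> cabled along these sets; chords are listed from bottom to top.\<close>

definition cabled :: "nc_series \<Rightarrow> nat set \<Rightarrow> nat set \<Rightarrow> nat set \<Rightarrow> (nat \<times> nat) list series" where
  "cabled \<phi> U V W d =
     (\<Sum>cs\<in>{cs. length cs = d \<and> set cs \<subseteq> U \<times> V \<union> V \<times> W}.
        Poly_Mapping.single cs (\<phi> (map (\<lambda>(p, q). p \<in> V) cs)))"

text \<open>\<open>exp (a \<Sum> t\<^sub>p\<^sub>q)\<close>, the sum over \<open>(p, q) \<in> S\<close>.\<close>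

definition exp_chords :: "rat \<Rightarrow> (nat \<times> nat) set \<Rightarrow> (nat \<times> nat) list series" where
  "exp_chords a S d =
     (\<Sum>cs\<in>{cs. length cs = d \<and> set cs \<subseteq> S}. Poly_Mapping.single cs (a ^ d / fact d))"

text \<open>A chord endpoint on a strand directed downward contributes the sign -1.\<close>

definition on_strands :: "strand list \<Rightarrow> (nat \<times> nat) list series \<Rightarrow> diagram series" where
  "on_strands xs F d =
     (\<Sum>cs\<in>Poly_Mapping.keys (F d).
        Poly_Mapping.single (horizontal_diagram xs cs)
          (Poly_Mapping.lookup (F d) cs *
           (\<Prod>(p, q)\<leftarrow>cs. orientation_sign (xs ! p) * orientation_sign (xs ! q))))"

definition upward :: "nat \<Rightarrow> strand list" where
  "upward k = map (\<lambda>c. (c, True)) [0..<k]"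

text \<open>Both sides of the pentagon go from \<open>((0 1) 2) 3\<close> to \<open>0 (1 (2 3))\<close>, read from bottom to top.
  Both sides of the hexagons go from \<open>(0 1) 2\<close> to \<open>1 (2 0)\<close>; chords are named by the strands they
  join, wherever these are.\<close>

definition pentagon :: "nc_series \<Rightarrow> bool" where
  "pentagon \<phi> \<longleftrightarrow>
     equal_mod_4T
       (on_strands (upward 4)
         (sprod (@) (cabled \<phi> {0, 1} {2} {3}) (cabled \<phi> {0} {1} {2, 3})))
       (on_strands (upward 4)
         (sprod (@) (cabled \<phi> {0} {1} {2})
           (sprod (@) (cabled \<phi> {0} {1, 2} {3}) (cabled \<phi> {1} {2} {3}))))"

definition hexagon :: "rat \<Rightarrow> nc_series \<Rightarrow> bool" where
  "hexagon \<epsilon> \<phi> \<longleftrightarrow>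
     equal_mod_4T
       (on_strands (upward 3)
         (sprod (@) (cabled \<phi> {0} {1} {2})
           (sprod (@) (exp_chords (\<epsilon> / 2) {(0, 1), (0, 2)}) (cabled \<phi> {1} {2} {0}))))
       (on_strands (upward 3)
         (sprod (@) (exp_chords (\<epsilon> / 2) {(0, 1)})
           (sprod (@) (cabled \<phi> {1} {0} {2}) (exp_chords (\<epsilon> / 2) {(0, 2)}))))"

definition drinfeld_associator :: "nc_series \<Rightarrow> bool" where
  "drinfeld_associator \<phi> \<longleftrightarrow> group_like \<phi> \<and> pentagon \<phi> \<and> hexagon 1 \<phi> \<and> hexagon (-1) \<phi>"


section \<open>The framed Kontsevich integral\<close>

definition on_word :: "(nat list \<Rightarrow> diagram) \<Rightarrow> nat list series \<Rightarrow> diagram series" where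
  "on_word g F d =
     (\<Sum>w\<in>Poly_Mapping.keys (F d). Poly_Mapping.single (g w) (Poly_Mapping.lookup (F d) w))"

text \<open>No orientation signs are needed for \<open>Cap\<close> and \<open>Cup\<close>, since both endpoints of each chord lie
  on the same strand.\<close>

fun Z :: "nc_series \<Rightarrow> qtangle \<Rightarrow> diagram series" where
  "Z \<phi> (Strand x) = sone (horizontal_diagram [x] [])"
| "Z \<phi> (Crossing e x y) = (\<lambda>k.
     Poly_Mapping.single (crossing_diagram x y [0..<k])
       ((if e then 1 else -1) ^ k / (2 ^ k * fact k)
         * orientation_sign x ^ k * orientation_sign y ^ k))"
| "Z \<phi> (Cap x) = on_word (cap_diagram x) sqrt_nu"
| "Z \<phi> (Cup x) = on_word (cup_diagram x) sqrt_nu"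
| "Z \<phi> (Reparenthesize e u v w) =
     (let a = length (points u); b = length (points v); c = length (points w)
      in on_strands (points u @ points v @ points w)
           (cabled (if e then \<phi> else nc_inverse \<phi>) {..<a} {a..<a + b} {a + b..<a + b + c}))"
| "Z \<phi> (Compose s t) = sprod (compose (width (top s))) (Z \<phi> s) (Z \<phi> t)"
| "Z \<phi> (Juxtapose s t) = sprod (juxtapose (width (bottom s)) (width (top s))) (Z \<phi> s) (Z \<phi> t)"

text \<open>The class modulo 4T of the value on a presentation of a link, as the set of its
  representatives.\<close>

definition kontsevich :: "nc_series \<Rightarrow> qtangle \<Rightarrow> diagram series set" where
  "kontsevich \<phi> t = {A. equal_mod_4T A (Z \<phi> t)}"

end

theory Submission
  imports Defs
begin

text \<open>
  Send a diagram to 1 if all its chords are of type \<open>(i, j)\<close> and to 0 otherwise.  The types of the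
  chords depend only on how many endpoints of each chord lie on each component, not on their order,
  so this functional kills the 4T relators, and it is multiplicative under composition and
  juxtaposition.  It therefore suffices to evaluate it on elementary q-tangles.  On caps and cups
  every chord joins a strand to itself, so only degree 0 contributes.  An associator is evaluated at
  commuting variables, where it is the exponential of its linear part; by the pentagon in degree 1
  this linear part vanishes.  A crossing of components \<open>i\<close> and \<open>j\<close> contributes
  \<open>exp (\<plusminus> h / 2)\<close>, and the product of all crossings is \<open>exp (\<ell>\<^sub>i\<^sub>j h)\<close>.
\<close>

section \<open>Linear functionals on formal sums\<close>

text \<open>Two functionals are needed. \<open>mixed_indicator\<close> also tests the components and
  a fixed degree: it reads off the sum of coefficients, but it is not multiplicative.
  \<open>type_indicator\<close> looks only at chord types and is multiplicative, the degree being
  carried by the index of the series. The two agree on the diagrams occurring in degree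
  \<open>n\<close> of the integral of a link, and the proof passes from one to the other there. The
  obstacle to multiplicativity is \<open>join\<close>: it returns its argument unchanged unless
  exactly one arc ends and exactly one starts at the given point, and it gives the glued arc the
  colour of only one of them. Hence boundary points are followed, together with their colours,
  through all compositions. The factor 1/2 in the exponent of a crossing comes from the denominator
  \<open>2 ^ k\<close>; it matches the linking number being half the sum of the crossing
  signs.\<close>

definition lin :: "('a \<Rightarrow> rat) \<Rightarrow> ('a \<Rightarrow>\<^sub>0 rat) \<Rightarrow> rat" where
  "lin g f = (\<Sum>x\<in>Poly_Mapping.keys f. Poly_Mapping.lookup f x * g x)"

lemma lin_superset:
  assumes "finite S" "Poly_Mapping.keys f \<subseteq> S"
  shows "lin g f = (\<Sum>x\<in>S. Poly_Mapping.lookup f x * g x)"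
  unfolding lin_def using assms by (intro sum.mono_neutral_left) (auto simp: in_keys_iff)

lemma lin_zero [simp]: "lin g 0 = 0"
  by (simp add: lin_def)

lemma lin_single [simp]: "lin g (Poly_Mapping.single x c) = c * g x"
  by (subst lin_superset[where S = "{x}"]) auto

lemma lin_add: "lin g (a + b) = lin g a + lin g b"
proof -
  let ?S = "Poly_Mapping.keys a \<union> Poly_Mapping.keys b"
  have "Poly_Mapping.keys (a + b) \<subseteq> ?S"
    by (rule Poly_Mapping.keys_add)
  then show ?thesis
    by (simp add: lin_superset[where S = ?S] lookup_add distrib_right sum.distrib)
qed

lemma lin_diff: "lin g (a - b) = lin g a - lin g b"
  using lin_add[of g "a - b" b] by simp

lemma lin_sum: "lin g (sum F A) = (\<Sum>x\<in>A. lin g (F x))"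
  by (induction A rule: infinite_finite_induct) (auto simp: lin_add)

lemma lookup_scale: "Poly_Mapping.lookup (scale c f) x = c * Poly_Mapping.lookup f x"
  by (simp add: scale_def Poly_Mapping.map.rep_eq when_def)

lemma keys_scale: "Poly_Mapping.keys (scale c f) \<subseteq> Poly_Mapping.keys f"
  by (auto simp: in_keys_iff lookup_scale)

lemma lin_scale: "lin g (scale c f) = c * lin g f"
  using lin_superset[OF finite_keys keys_scale, of g c f]
  by (simp add: lookup_scale lin_def sum_distrib_left mult.assoc)

lemma lin_cong: "(\<And>x. x \<in> Poly_Mapping.keys f \<Longrightarrow> g x = h x) \<Longrightarrow> lin g f = lin h f"
  by (simp add: lin_def)

lemma keys_sum_elem:
  assumes "x \<in> Poly_Mapping.keys (sum F A)"
  shows "\<exists>a\<in>A. x \<in> Poly_Mapping.keys (F a)"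
  using keys_sum[of F A] assms by blast

lemma keys_singleD: "x \<in> Poly_Mapping.keys (Poly_Mapping.single y c) \<Longrightarrow> x = y"
  by (simp split: if_splits)

lemma keys_sprodE:
  assumes "z \<in> Poly_Mapping.keys (sprod mul F G d)"
  obtains i x y where "i \<le> d" "x \<in> Poly_Mapping.keys (F i)" "y \<in> Poly_Mapping.keys (G (d - i))"
    "z = mul x y"
  using assms unfolding sprod_def
  by (auto dest!: keys_sum_elem keys_singleD)

text \<open>Multiplicativity is asked only on the keys because gluing is multiplicative only for
  diagrams whose boundaries match. The conclusion is a Cauchy product, so a multiplicative
  functional turns series of diagrams into power series in one variable.\<close>

lemma lin_sprod:
  assumes "\<And>a x y. a \<le> d \<Longrightarrow> x \<in> Poly_Mapping.keys (F a) \<Longrightarrow> y \<in> Poly_Mapping.keys (G (d - a))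
    \<Longrightarrow> g (mul x y) = h x * k y"
  shows "lin g (sprod mul F G d) = (\<Sum>a\<le>d. lin h (F a) * lin k (G (d - a)))"
  unfolding sprod_def lin_sum lin_single
  by (rule sum.cong[OF refl]) (auto simp: lin_def sum_product assms intro!: sum.cong)

section \<open>Occurrences of chord endpoints\<close>

text \<open>Exactly the data on which chord types depend. The order of endpoints along a component
  is dropped, and this order is what 4T relators, base points and gluing affect.\<close>

definition occurrences :: "'l code \<Rightarrow> ('l \<times> nat) multiset" where
  "occurrences D = (\<Sum>(s, w)\<leftarrow>D. image_mset (\<lambda>x. (x, colour s)) (mset w))"

definition occurrence_type :: "('l \<times> nat) multiset \<Rightarrow> 'l \<Rightarrow> nat multiset" where
  "occurrence_type M x = image_mset snd (filter_mset (\<lambda>y. fst y = x) M)"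

definition only_type :: "nat \<Rightarrow> nat \<Rightarrow> ('l \<times> nat) multiset \<Rightarrow> bool" where
  "only_type i j M \<longleftrightarrow> (\<forall>x\<in>fst ` set_mset M. occurrence_type M x = {#i, j#})"

lemma occurrences_simps [simp]:
  "occurrences [] = {#}"
  "occurrences (x # D) = image_mset (\<lambda>l. (l, colour (fst x))) (mset (snd x)) + occurrences D"
  "occurrences (D @ E) = occurrences D + occurrences E"
  by (auto simp: occurrences_def split: prod.splits)

lemma occurrences_mset_cong: "mset D = mset E \<Longrightarrow> occurrences D = occurrences E"
  unfolding occurrences_def sum_mset_sum_list[symmetric] mset_map by simp

lemma mset_letters: "mset (letters D) = image_mset fst (occurrences D)"
  by (induction D) (auto simp: letters_def image_mset.compositionality comp_def)

lemma set_letters: "set (letters D) = fst ` set_mset (occurrences D)"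
  by (metis mset_letters set_image_mset set_mset_mset)

lemma replicate_count_list:
  "replicate_mset (count_list w x) c =
    image_mset snd (filter_mset (\<lambda>y. fst y = x) (image_mset (\<lambda>l. (l, c)) (mset w)))"
  by (induction w) auto

lemma chord_type_occurrences: "chord_type D x = occurrence_type (occurrences D) x"
proof (induction D)
  case Nil
  then show ?case by (simp add: chord_type_def occurrence_type_def)
next
  case (Cons y D)
  obtain s w where y: "y = (s, w)" by fastforce
  have "chord_type (y # D) x = replicate_mset (count_list w x) (colour s) + chord_type D x"
    by (simp add: chord_type_def y)
  then show ?case
    by (simp add: Cons replicate_count_list y occurrence_type_def del: filter_mset_image_mset)
qed

lemma occurrence_type_add: "occurrence_type (M + N) x = occurrence_type M x + occurrence_type N x"
  by (simp add: occurrence_type_def)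

lemma occurrence_type_empty: "x \<notin> fst ` set_mset M \<Longrightarrow> occurrence_type M x = {#}"
  by (force simp: occurrence_type_def)

lemma occurrence_type_image:
  assumes "inj_on f (fst ` set_mset M)" "x \<in> fst ` set_mset M"
  shows "occurrence_type (image_mset (map_prod f id) M) (f x) = occurrence_type M x"
proof -
  have "filter_mset (\<lambda>y. f (fst y) = f x) M = filter_mset (\<lambda>y. fst y = x) M"
    using assms by (intro filter_mset_cong refl) (auto dest: inj_onD)
  then show ?thesis
    by (simp add: occurrence_type_def filter_mset_image_mset image_mset.compositionality comp_def)
qed

lemma fst_set_map_prod:
  "fst ` set_mset (image_mset (map_prod f id) M) = f ` fst ` set_mset M"
  by (auto simp: image_image)

lemma only_type_image:
  assumes "inj_on f (fst ` set_mset M)"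
  shows "only_type i j (image_mset (map_prod f id) M) \<longleftrightarrow> only_type i j M"
  unfolding only_type_def fst_set_map_prod using occurrence_type_image[OF assms] by auto

text \<open>With disjoint names no chord has endpoints in both summands, so each type is computed
  inside one of them.\<close>

lemma only_type_add:
  assumes "fst ` set_mset M \<inter> fst ` set_mset N = {}"
  shows "only_type i j (M + N) \<longleftrightarrow> only_type i j M \<and> only_type i j N"
proof -
  have 1: "occurrence_type (M + N) x = occurrence_type M x" if "x \<in> fst ` set_mset M" for x
  proof -
    from that assms have "x \<notin> fst ` set_mset N" by blast
    then show ?thesis by (simp add: occurrence_type_add occurrence_type_empty)
  qed
  have 2: "occurrence_type (M + N) x = occurrence_type N x" if "x \<in> fst ` set_mset N" for x
  proof -
    from that assms have "x \<notin> fst ` set_mset M" by blast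
    then show ?thesis by (simp add: occurrence_type_add occurrence_type_empty)
  qed
  show ?thesis
    unfolding only_type_def set_mset_union image_Un ball_Un using 1 2 by auto
qed

lemma only_type_empty [simp]: "only_type i j {#}"
  by (simp add: only_type_def)

text \<open>A type \<open>{#i, j#}\<close> has size 2, so every chord has two endpoints. Thus
  validity of codes need not be followed through the integral.\<close>

lemma is_diagram_if_only_type:
  assumes "only_type i j (occurrences D)"
  shows "is_diagram D"
  unfolding is_diagram_def
proof
  fix x assume "x \<in> set (letters D)"
  then have "occurrence_type (occurrences D) x = {#i, j#}"
    using assms unfolding only_type_def set_letters by blast
  then have "size (filter_mset (\<lambda>y. fst y = x) (occurrences D)) = 2"
    by (metis occurrence_type_def size_image_mset size_add_mset size_empty numeral_2_eq_2)
  moreover have "size (filter_mset (\<lambda>y. fst y = x) M) = count (image_mset fst M) x" for M :: "(nat \<times> nat) multiset"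
    by (induction M) auto
  ultimately have "count (mset (letters D)) x = 2"
    by (simp add: mset_letters)
  then show "count_list (letters D) x = 2"
    by (simp add: count_mset)
qed

section \<open>Products of diagrams: even and odd chord names\<close>

definition disjoint_sum :: "(nat \<times> nat) multiset \<Rightarrow> (nat \<times> nat) multiset \<Rightarrow> (nat \<times> nat) multiset"
  where "disjoint_sum M N =
    image_mset (map_prod (\<lambda>x. 2 * x) id) M + image_mset (map_prod (\<lambda>x. 2 * x + 1) id) N"

lemma names_disjoint: "(\<lambda>x. 2 * x) ` A \<inter> (\<lambda>x. 2 * x + 1) ` B = {}" for A B :: "nat set"
  by (auto, presburger)

lemma only_type_disjoint_sum:
  "only_type i j (disjoint_sum M N) \<longleftrightarrow> only_type i j M \<and> only_type i j N"
  unfolding disjoint_sum_def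
  by (subst only_type_add) (simp_all only: fst_set_map_prod names_disjoint only_type_image inj_on_def, auto simp: only_type_image inj_on_def)

lemma degree_occurrences: "degree D = card (fst ` set_mset (occurrences D))"
  by (simp add: degree_def set_letters)

lemma card_disjoint_sum:
  "card (fst ` set_mset (disjoint_sum M N)) =
    card (fst ` set_mset M) + card (fst ` set_mset N)"
proof -
  have "fst ` set_mset (disjoint_sum M N) =
      (\<lambda>x. 2 * x) ` fst ` set_mset M \<union> (\<lambda>x. 2 * x + 1) ` fst ` set_mset N"
    by (simp only: disjoint_sum_def set_mset_union image_Un fst_set_map_prod)
  moreover have "card ((\<lambda>x. 2 * x) ` fst ` set_mset M) = card (fst ` set_mset M)"
    "card ((\<lambda>x. 2 * x + 1) ` fst ` set_mset N) = card (fst ` set_mset N)"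
    by (auto intro!: card_image simp: inj_on_def)
  ultimately show ?thesis
    by (simp add: card_Un_disjoint names_disjoint[simplified])
qed

lemma occurrences_map_words_map:
  "occurrences (map_words (map f) D) = image_mset (map_prod f id) (occurrences D)"
  by (induction D) (auto simp: map_words_def image_mset.compositionality comp_def)

lemma occurrences_left_names:
  "occurrences (map_words left_names D) = image_mset (map_prod (\<lambda>x. 2 * x) id) (occurrences D)"
  by (metis left_names_def occurrences_map_words_map ext)

lemma occurrences_right_names:
  "occurrences (map_words right_names D) = image_mset (map_prod (\<lambda>x. 2 * x + 1) id) (occurrences D)"
  by (metis right_names_def occurrences_map_words_map ext)

lemma colour_map_points [simp]: "colour (map_points g s) = colour s"
  by (cases s) auto

lemma occurrences_move [simp]: "occurrences (move g D) = occurrences D"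
  by (induction D) (auto simp: move_def)

section \<open>A functional vanishing on the relations\<close>

lemma mset_fill_slot_cong:
  assumes "mset ps = mset ps'" "mset qs = mset qs'" "mset rs = mset rs'"
  shows "mset (concat (map (fill_slot ps qs rs) w)) = mset (concat (map (fill_slot ps' qs' rs') w))"
proof (induction w)
  case (Cons s w)
  then show ?case using assms by (cases s) auto
qed simp

lemma occurrences_fill_cong:
  assumes "mset ps = mset ps'" "mset qs = mset qs'" "mset rs = mset rs'"
  shows "occurrences (fill ps qs rs T) = occurrences (fill ps' qs' rs' T)"
  using mset_fill_slot_cong[OF assms]
  by (induction T) (auto simp: fill_def map_words_def)

lemma fst_fill: "map fst (fill ps qs rs T) = map fst T"
  by (auto simp: fill_def map_words_def)

lemma mset_rotate: "mset (rotate r v) = mset v"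
proof (induction r)
  case (Suc r)
  have "mset (rotate1 u) = mset u" for u :: "'a list" by (cases u) auto
  then show ?case using Suc by simp
qed simp

lemma same_up_to_base_point_invariants:
  assumes "list_all2 same_up_to_base_point D E"
  shows "map fst D = map fst E" "occurrences D = occurrences E"
proof -
  have *: "fst x = fst y \<and> mset (snd x) = mset (snd y)" if "same_up_to_base_point x y" for x y
    using that by (cases "(x, y)" rule: same_up_to_base_point.cases) (auto simp: mset_rotate)
  have "map fst D = map fst E \<and> occurrences D = occurrences E"
    by (rule list_all2_induct[OF assms]) (auto dest: *)
  then show "map fst D = map fst E" "occurrences D = occurrences E" by auto
qed

text \<open>Reordering components and rotating words leave \<open>occurrences\<close> unchanged, so
  only the renaming of chords remains visible.\<close>

lemma diagram_isoE:
  assumes "diagram_iso D E"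
  obtains f where "inj_on f (fst ` set_mset (occurrences D))"
    "occurrences E = image_mset (map_prod f id) (occurrences D)"
    "mset (map fst E) = mset (map fst D)"
proof -
  obtain f D' where f: "inj_on f (set (letters D))" "mset D' = mset (map_words (map f) D)"
      "list_all2 same_up_to_base_point D' E"
    using assms by (auto simp: diagram_iso_def)
  have "occurrences E = image_mset (map_prod f id) (occurrences D)"
    using occurrences_mset_cong[OF f(2)] same_up_to_base_point_invariants(2)[OF f(3)]
    by (simp add: occurrences_map_words_map)
  moreover have "mset (map fst E) = mset (map fst (map_words (map f) D))"
    using f(2) by (simp flip: same_up_to_base_point_invariants(1)[OF f(3)])
  then have "mset (map fst E) = mset (map fst D)"
    by (simp add: map_words_def comp_def case_prod_beta)
  ultimately show thesis
    using that[OF f(1)[unfolded set_letters]] by blast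
qed

text \<open>The degree is tested because the parts of a representative need not be homogeneous:
  \<open>relations\<close> contains relators of all degrees. The condition \<open>P\<close> on
  components is that of circles 1 to m for links, and is trivial when the pentagon is
  evaluated.\<close>

definition mixed_indicator ::
  "(component multiset \<Rightarrow> bool) \<Rightarrow> nat \<Rightarrow> nat \<Rightarrow> nat \<Rightarrow> diagram \<Rightarrow> rat" where
  "mixed_indicator P i j n D =
     of_bool (P (mset (map fst D)) \<and> only_type i j (occurrences D) \<and> degree D = n)"

lemma degree_iso:
  assumes "diagram_iso D E"
  shows "degree E = degree D"
  using assms
  by (rule diagram_isoE) (simp only: degree_occurrences fst_set_map_prod card_image)

lemma mixed_indicator_iso:
  assumes "diagram_iso D E"
  shows "mixed_indicator P i j n E = mixed_indicator P i j n D"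
proof -
  obtain f where f: "inj_on f (fst ` set_mset (occurrences D))"
    "occurrences E = image_mset (map_prod f id) (occurrences D)"
    "mset (map fst E) = mset (map fst D)"
    using diagram_isoE[OF assms] .
  show ?thesis
    unfolding mixed_indicator_def degree_iso[OF assms] f(3) unfolding f(2) only_type_image[OF f(1)] by simp
qed

lemma mixed_indicator_cong:
  assumes "map fst D = map fst E" "occurrences D = occurrences E"
  shows "mixed_indicator P i j n D = mixed_indicator P i j n E"
  using assms by (simp add: mixed_indicator_def degree_occurrences del: mset_map)

text \<open>The four diagrams of a relator cancel in pairs, because they differ only in the order of the
  endpoints on one arc.\<close>

lemma lin_relations:
  assumes "a \<in> relations"
  shows "lin (mixed_indicator P i j n) a = 0"
  using assms
proof induction
  case (four_T a T c)
  have "mixed_indicator P i j n (fill [0, 1] [0] [1] T) = mixed_indicator P i j n (fill [1, 0] [0] [1] T)"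
    "mixed_indicator P i j n (fill [0] [0, 1] [1] T) = mixed_indicator P i j n (fill [0] [1, 0] [1] T)"
    by (intro mixed_indicator_cong occurrences_fill_cong; simp add: fst_fill add_mset_commute)+
  then show ?case
    using four_T by (simp add: lin_add lin_diff lin_scale four_T_def)
qed (auto simp: lin_add lin_diff lin_scale mixed_indicator_iso)

lemma lin_equal_mod_4T:
  assumes "equal_mod_4T A B"
  shows "lin (mixed_indicator P i j n) (A d) = lin (mixed_indicator P i j n) (B d)"
proof -
  have "A d - B d \<in> relations"
    using assms by (simp add: equal_mod_4T_def)
  from lin_relations[OF this, of P i j n] show ?thesis
    by (simp add: lin_diff)
qed

section \<open>Noncommutative series evaluated at commuting variables\<close>

lemma finite_lists_of_length: "finite A \<Longrightarrow> finite {xs. length xs = d \<and> set xs \<subseteq> A}"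
  by (rule finite_subset[OF _ finite_lists_length_eq[of A d]]) auto

lemma sum_lists_Suc:
  "(\<Sum>xs\<in>{xs. length xs = Suc d \<and> set xs \<subseteq> A}. f xs) =
    (\<Sum>x\<in>A. \<Sum>xs\<in>{xs. length xs = d \<and> set xs \<subseteq> A}. f (x # xs))"
  unfolding sum.cartesian_product
  by (rule sum.reindex_bij_witness[of _ "\<lambda>(x, xs). x # xs" "\<lambda>xs. (hd xs, tl xs)"])
    (auto simp: length_Suc_conv)

lemma sum_lists_add:
  "(\<Sum>w\<in>{w. length w = k + l}. f (take k w) (drop k w)) =
    (\<Sum>u\<in>{u. length u = k}. \<Sum>v\<in>{v. length v = l}. f u v)"
  unfolding sum.cartesian_product
  by (rule sum.reindex_bij_witness[of _ "\<lambda>(u, v). u @ v" "\<lambda>w. (take k w, drop k w)"]) auto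

definition commutative_value :: "nc_series \<Rightarrow> (bool \<Rightarrow> rat) \<Rightarrow> nat \<Rightarrow> rat" where
  "commutative_value \<phi> \<gamma> d = (\<Sum>w\<in>{w. length w = d}. \<phi> w * (\<Prod>b\<leftarrow>w. \<gamma> b))"

lemma commutative_value_0: "commutative_value \<phi> \<gamma> 0 = \<phi> []"
  by (simp add: commutative_value_def)

text \<open>This is the substitution of a sum for each letter: lists are grouped by their words of
  marks, and the elements with mark \<open>b\<close> contribute their total weight. The induction
  removes the first element, after which the remaining list is weighted by
  \<open>\<lambda>w. \<phi> (b # w)\<close>; hence \<open>\<phi>\<close> is arbitrary.\<close>

lemma sum_lists_marked:
  fixes wt :: "'a \<Rightarrow> rat"
  assumes "finite E"
  shows "(\<Sum>cs\<in>{cs. length cs = d \<and> set cs \<subseteq> E}. \<phi> (map \<kappa> cs) * (\<Prod>c\<leftarrow>cs. wt c)) =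
    commutative_value \<phi> (\<lambda>b. \<Sum>e | e \<in> E \<and> \<kappa> e = b. wt e) d"
proof (induction d arbitrary: \<phi>)
  case 0
  have "{cs. cs = [] \<and> set cs \<subseteq> E} = {[]}" by auto
  then show ?case by (simp add: commutative_value_def)
next
  case (Suc d)
  let ?\<gamma> = "\<lambda>b. \<Sum>e | e \<in> E \<and> \<kappa> e = b. wt e"
  have "(\<Sum>cs\<in>{cs. length cs = Suc d \<and> set cs \<subseteq> E}. \<phi> (map \<kappa> cs) * (\<Prod>c\<leftarrow>cs. wt c)) =
      (\<Sum>e\<in>E. \<Sum>cs\<in>{cs. length cs = d \<and> set cs \<subseteq> E}. wt e * (\<phi> (\<kappa> e # map \<kappa> cs) * (\<Prod>c\<leftarrow>cs. wt c)))"
    by (simp add: sum_lists_Suc mult.left_commute)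
  also have "\<dots> = (\<Sum>e\<in>E. wt e * commutative_value (\<lambda>w. \<phi> (\<kappa> e # w)) ?\<gamma> d)"
    by (simp flip: Suc add: sum_distrib_left)
  also have "\<dots> = (\<Sum>b\<in>UNIV. \<Sum>e | e \<in> E \<and> \<kappa> e = b. wt e * commutative_value (\<lambda>w. \<phi> (\<kappa> e # w)) ?\<gamma> d)"
    using assms by (intro sum.group[symmetric]) auto
  also have "\<dots> = (\<Sum>b\<in>UNIV. ?\<gamma> b * commutative_value (\<lambda>w. \<phi> (b # w)) ?\<gamma> d)"
    by (simp add: sum_distrib_right)
  also have "\<dots> = (\<Sum>b\<in>UNIV. \<Sum>w\<in>{w. length w = d \<and> set w \<subseteq> UNIV}. \<phi> (b # w) * (?\<gamma> b * (\<Prod>b\<leftarrow>w. ?\<gamma> b)))"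
    by (simp only: commutative_value_def sum_distrib_left subset_UNIV simp_thms mult.left_commute)
  also have "\<dots> = (\<Sum>w\<in>{w. length w = Suc d \<and> set w \<subseteq> UNIV}. \<phi> w * (\<Prod>b\<leftarrow>w. ?\<gamma> b))"
    by (simp only: sum_lists_Suc list.map prod_list.Cons)
  finally show ?case
    by (simp add: commutative_value_def)
qed

lemma prod_list_nths:
  fixes f :: "'a \<Rightarrow> 'b :: comm_monoid_mult"
  shows "(\<Prod>b\<leftarrow>w. f b) = (\<Prod>b\<leftarrow>nths w S. f b) * (\<Prod>b\<leftarrow>nths w (- S). f b)"
proof (induction w arbitrary: S)
  case (Cons x w)
  have "{j. Suc j \<in> - S} = - {j. Suc j \<in> S}" by auto
  then show ?case
    using Cons[of "{j. Suc j \<in> S}"] by (simp add: nths_Cons ac_simps)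
qed simp

text \<open>A set of positions determines the words read on it and off it, so the sum counts each
  one-element set of positions once.\<close>

lemma card_splittings:
  fixes w :: "bool list"
  assumes "length w = Suc d"
  shows "(\<Sum>u\<in>{u. length u = 1}. \<Sum>v\<in>{v. length v = d}.
      card {S. S \<subseteq> {..<length w} \<and> nths w S = u \<and> nths w (- S) = v}) = Suc d"
proof -
  let ?N = "{S. S \<subseteq> {..<Suc d} \<and> card S = 1}"
  let ?X = "{u :: bool list. length u = 1} \<times> {v :: bool list. length v = d}"
  let ?S = "\<lambda>x. {S. S \<subseteq> {..<length w} \<and> nths w S = fst x \<and> nths w (- S) = snd x}"
  have fin: "finite {w :: bool list. length w = n}" for n :: nat
    using finite_lists_of_length[of "UNIV :: bool set" n] by simp
  have len: "length (nths w S) = card S" "length (nths w (- S)) = Suc d - card S"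
    if "S \<subseteq> {..<Suc d}" for S
  proof -
    have "{k. k < length w \<and> k \<in> S} = S" "{k. k < length w \<and> k \<in> - S} = {..<Suc d} - S"
      using that assms by auto
    then show "length (nths w S) = card S" "length (nths w (- S)) = Suc d - card S"
      using that by (simp_all add: length_nths card_Diff_subset finite_subset[OF that])
  qed
  have "Suc d = card ?N"
    using n_subsets[of "{..<Suc d}" 1] by simp
  also have "?N = (\<Union>x\<in>?X. ?S x)"
  proof (intro equalityI subsetI)
    fix S assume "S \<in> ?N"
    then show "S \<in> (\<Union>x\<in>?X. ?S x)"
      using len[of S] assms by (intro UN_I[of "(nths w S, nths w (- S))"]) simp_all
  next
    fix S assume "S \<in> (\<Union>x\<in>?X. ?S x)"
    then obtain x where "x \<in> ?X" "S \<in> ?S x" by (rule UN_E)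
    then show "S \<in> ?N"
      using len(1)[of S] assms by auto
  qed
  also have "card \<dots> = (\<Sum>x\<in>?X. card (?S x))"
    using fin assms by (intro card_UN_disjoint) auto
  finally show ?thesis
    by (simp add: sum.cartesian_product case_prod_beta)
qed

text \<open>On commuting variables, a group-like series is the exponential of its linear part.\<close>

lemma commutative_value_group_like:
  assumes "group_like \<phi>" "\<phi> [False] = 0" "\<phi> [True] = 0" "d > 0"
  shows "commutative_value \<phi> \<gamma> d = 0"
proof -
  obtain k where d: "d = Suc k" using assms(4) by (cases d) auto
  let ?c = "\<lambda>w. \<Prod>b\<leftarrow>w. \<gamma> b"
  let ?U = "{u :: bool list. length u = 1}" and ?V = "{v :: bool list. length v = k}"
    and ?W = "{w :: bool list. length w = Suc k}"
  let ?n = "\<lambda>u v w. card {S. S \<subseteq> {..<length w} \<and> nths w S = u \<and> nths w (- S) = v}"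
  \<comment> \<open>If \<open>w\<close> splits into \<open>u\<close> and \<open>v\<close>,
    commutativity makes its weight the product of theirs; otherwise the count is 0 on both
    sides.\<close>
  have *: "?c u * ?c v * of_nat (?n u v w) = ?c w * of_nat (?n u v w)" for u v w
  proof (cases "?n u v w = 0")
    case False
    then obtain S where "nths w S = u" "nths w (- S) = v"
      by (auto simp: card_eq_0_iff)
    then show ?thesis using prod_list_nths[of \<gamma> w S] by simp
  qed simp
  have "\<phi> u = 0" if "u \<in> ?U" for u
  proof -
    from that obtain b where "u = [b]" by (auto simp: length_Suc_conv)
    then show ?thesis using assms(2,3) by (cases b) auto
  qed
  \<comment> \<open>The sum is the linear part times the degree \<open>k\<close> part.
    Group-likeness rewrites it as \<open>Suc k\<close> times the part of degree
    \<open>Suc k\<close>, since a word of that length has \<open>Suc k\<close> positions for the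
    single letter.\<close>
  then have "0 = (\<Sum>u\<in>?U. \<Sum>v\<in>?V. ?c u * ?c v * (\<phi> u * \<phi> v))"
    by simp
  also have "\<dots> = (\<Sum>u\<in>?U. \<Sum>v\<in>?V. ?c u * ?c v * (\<Sum>w\<in>?W. \<phi> w * of_nat (?n u v w)))"
    using assms(1) by (auto simp: group_like_def intro!: sum.cong)
  also have "\<dots> = (\<Sum>u\<in>?U. \<Sum>v\<in>?V. \<Sum>w\<in>?W. \<phi> w * ?c w * of_nat (?n u v w))"
    unfolding sum_distrib_left
    using * by (intro sum.cong refl) (metis (no_types, lifting) mult.assoc mult.left_commute)
  also have "\<dots> = (\<Sum>w\<in>?W. \<phi> w * ?c w * of_nat (\<Sum>u\<in>?U. \<Sum>v\<in>?V. ?n u v w))"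
    unfolding of_nat_sum sum_distrib_left sum.swap[of _ ?W ?V] sum.swap[of _ ?W ?U] ..
  also have "\<dots> = (\<Sum>w\<in>?W. \<phi> w * ?c w * of_nat (Suc k))"
    by (intro sum.cong refl) (subst card_splittings, simp_all)
  also have "\<dots> = commutative_value \<phi> \<gamma> d * of_nat (Suc k)"
    by (simp only: commutative_value_def d sum_distrib_right)
  finally show ?thesis by simp
qed

text \<open>Evaluation is multiplicative for concatenation, so the recursion defining the inverse
  becomes that of a commutative power series; each summand contains a value of \<open>\<phi>\<close>
  in positive degree.\<close>

lemma commutative_value_inverse:
  assumes "\<And>k. k > 0 \<Longrightarrow> commutative_value \<phi> \<gamma> k = 0" "d > 0"
  shows "commutative_value (nc_inverse \<phi>) \<gamma> d = 0"
proof -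
  let ?c = "\<lambda>w. \<Prod>b\<leftarrow>w. \<gamma> b"
  have c: "?c w = ?c (take k w) * ?c (drop k w)" for k and w :: "bool list"
    by (metis append_take_drop_id map_append prod_list.append)
  have "commutative_value (nc_inverse \<phi>) \<gamma> d =
      (\<Sum>w\<in>{w. length w = d}. - (\<Sum>k\<in>{1..d}.
        (\<phi> (take k w) * ?c (take k w)) * (nc_inverse \<phi> (drop k w) * ?c (drop k w))))"
    unfolding commutative_value_def
  proof (intro sum.cong refl)
    fix w :: "bool list" assume w: "w \<in> {w. length w = d}"
    then have "w \<noteq> []" using assms(2) by auto
    then have "nc_inverse \<phi> w = - (\<Sum>k\<in>{1..d}. \<phi> (take k w) * nc_inverse \<phi> (drop k w))"
      using w by (subst nc_inverse.simps) (simp del: nc_inverse.simps)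
    then have "nc_inverse \<phi> w * ?c w = - (\<Sum>k\<in>{1..d}. \<phi> (take k w) * nc_inverse \<phi> (drop k w) * ?c w)"
      by (simp only: sum_distrib_right mult_minus_left)
    also have "\<dots> = - (\<Sum>k\<in>{1..d}. (\<phi> (take k w) * ?c (take k w)) * (nc_inverse \<phi> (drop k w) * ?c (drop k w)))"
      unfolding sum_negf[symmetric]
    proof (intro sum.cong refl)
      fix k
      show "- (\<phi> (take k w) * nc_inverse \<phi> (drop k w) * ?c w) =
          - ((\<phi> (take k w) * ?c (take k w)) * (nc_inverse \<phi> (drop k w) * ?c (drop k w)))"
        unfolding c[of w k] by simp
    qed
    finally show "nc_inverse \<phi> w * ?c w = \<dots>" .
  qed
  also have "\<dots> = - (\<Sum>k\<in>{1..d}. \<Sum>w\<in>{w. length w = d}.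
      (\<phi> (take k w) * ?c (take k w)) * (nc_inverse \<phi> (drop k w) * ?c (drop k w)))"
    unfolding sum_negf by (subst sum.swap) (rule refl)
  also have "\<dots> = - (\<Sum>k\<in>{1..d}. commutative_value \<phi> \<gamma> k * commutative_value (nc_inverse \<phi>) \<gamma> (d - k))"
  proof (intro arg_cong[where f = uminus] sum.cong refl)
    fix k assume "k \<in> {1..d}"
    then have "{w :: bool list. length w = d} = {w. length w = k + (d - k)}" by auto
    then show "(\<Sum>w\<in>{w. length w = d}.
        (\<phi> (take k w) * ?c (take k w)) * (nc_inverse \<phi> (drop k w) * ?c (drop k w))) =
        commutative_value \<phi> \<gamma> k * commutative_value (nc_inverse \<phi>) \<gamma> (d - k)"
      using sum_lists_add[of "\<lambda>u v. (\<phi> u * ?c u) * (nc_inverse \<phi> v * ?c v)" k "d - k"]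
      by (simp only: commutative_value_def sum_product)
  qed
  also have "\<dots> = 0"
    using assms(1) by simp
  finally show ?thesis .
qed

section \<open>Boundaries of diagrams\<close>

text \<open>Colours accompany the points because gluing preserves \<open>occurrences\<close> only
  when the two glued arcs have the same colour.\<close>

fun source :: "component \<Rightarrow> (point \<times> nat) multiset" where
  "source (Arc p q c) = {#(p, c)#}"
| "source (Circle c) = {#}"

fun target :: "component \<Rightarrow> (point \<times> nat) multiset" where
  "target (Arc p q c) = {#(q, c)#}"
| "target (Circle c) = {#}"

definition sources :: "'l code \<Rightarrow> (point \<times> nat) multiset" where
  "sources D = (\<Sum>(s, w)\<leftarrow>D. source s)"

definition targets :: "'l code \<Rightarrow> (point \<times> nat) multiset" where
  "targets D = (\<Sum>(s, w)\<leftarrow>D. target s)"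

lemma sources_simps [simp]:
  "sources [] = {#}" "sources (x # D) = source (fst x) + sources D"
  "sources (D @ E) = sources D + sources E"
  by (auto simp: sources_def split: prod.splits)

lemma targets_simps [simp]:
  "targets [] = {#}" "targets (x # D) = target (fst x) + targets D"
  "targets (D @ E) = targets D + targets E"
  by (auto simp: targets_def split: prod.splits)

lemma sources_mset_cong: "mset D = mset E \<Longrightarrow> sources D = sources E"
  unfolding sources_def sum_mset_sum_list[symmetric] mset_map by simp

lemma targets_mset_cong: "mset D = mset E \<Longrightarrow> targets D = targets E"
  unfolding targets_def sum_mset_sum_list[symmetric] mset_map by simp

lemma sources_conv: "sources D = (\<Sum>s\<leftarrow>map fst D. source s)"
  by (induction D) auto

lemma targets_conv: "targets D = (\<Sum>s\<leftarrow>map fst D. target s)"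
  by (induction D) auto

lemma sources_move: "sources (move g D) = image_mset (map_prod g id) (sources D)"
proof (induction D)
  case (Cons x D)
  then show ?case by (cases "fst x") (auto simp: move_def split: prod.splits)
qed (simp add: move_def)

lemma targets_move: "targets (move g D) = image_mset (map_prod g id) (targets D)"
proof (induction D)
  case (Cons x D)
  then show ?case by (cases "fst x") (auto simp: move_def split: prod.splits)
qed (simp add: move_def)

lemma fst_map_words [simp]: "map fst (map_words f D) = map fst D"
  by (auto simp: map_words_def)

lemma sources_map_words [simp]: "sources (map_words f D) = sources D"
  by (simp add: sources_conv)

lemma targets_map_words [simp]: "targets (map_words f D) = targets D"
  by (simp add: targets_conv)

lemma length_filter_starts:
  "length (filter (\<lambda>x. starts_at p (fst x)) D) = size (filter_mset (\<lambda>y. fst y = p) (sources D))"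
proof (induction D)
  case (Cons x D)
  then show ?case by (cases "fst x") (auto split: prod.splits)
qed simp

lemma length_filter_ends:
  "length (filter (\<lambda>x. ends_at p (fst x)) D) = size (filter_mset (\<lambda>y. fst y = p) (targets D))"
proof (induction D)
  case (Cons x D)
  then show ?case by (cases "fst x") (auto split: prod.splits)
qed simp

lemma source_in_sources: "(Arc p q c, w) \<in> set D \<Longrightarrow> (p, c) \<in># sources D"
  by (induction D) auto

lemma target_in_targets: "(Arc p q c, w) \<in> set D \<Longrightarrow> (q, c) \<in># targets D"
  by (induction D) auto

text \<open>The hypotheses say that one arc starts and one ends at \<open>p\<close>, both of colour
  \<open>c\<close>, which selects the proper branch of \<open>join\<close>. The endpoint words are
  then concatenated under an unchanged colour, or a single arc closes up.\<close>

lemma join_invariants: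
  assumes S: "sources D = add_mset (p, c) X" and T: "targets D = add_mset (p, c) Y"
    and p: "\<And>y. y \<in># X + Y \<Longrightarrow> fst y \<noteq> p"
  shows "sources (join p D) = X" "targets (join p D) = Y"
    "occurrences (join p D) = occurrences D"
proof -
  let ?s = "\<lambda>x. starts_at p (fst x)" and ?e = "\<lambda>x. ends_at p (fst x)"
  define R where "R = filter (\<lambda>x. \<not> ?e x \<and> \<not> ?s x) D"
  have "filter_mset (\<lambda>y. fst y = p) X = {#}" "filter_mset (\<lambda>y. fst y = p) Y = {#}"
    using p by auto
  then have "length (filter ?s D) = Suc 0" "length (filter ?e D) = Suc 0"
    by (simp_all add: length_filter_starts length_filter_ends S T)
  then obtain x y where x: "filter ?s D = [x]" and y: "filter ?e D = [y]"
    unfolding length_Suc_conv length_0_conv by blast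
  have "x \<in> set (filter ?s D)" "y \<in> set (filter ?e D)"
    by (simp_all add: x y)
  then have xs: "x \<in> set D" "?s x" and ys: "y \<in> set D" "?e y"
    by simp_all
  obtain b c1 w where x_eq: "x = (Arc p b c1, w)"
    using xs(2) by (cases x; cases "fst x") auto
  obtain a c2 v where y_eq: "y = (Arc a p c2, v)"
    using ys(2) by (cases y; cases "fst y") auto
  have "c1 = c" "c2 = c"
    using source_in_sources[of p b c1 w D] target_in_targets[of a p c2 v D] xs ys x_eq y_eq p S T
    by fastforce+
  then have x_eq: "x = (Arc p b c, w)" and y_eq: "y = (Arc a p c, v)"
    using x_eq y_eq by auto
  have join: "join p D = (if a = p then (Circle c, v) else (Arc a b c, v @ w)) # R"
    unfolding join_def R_def split_beta' x y by (simp add: x_eq y_eq)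
  \<comment> \<open>Arcs that also end at \<open>p\<close> are removed from the last list, so that
    an arc from \<open>p\<close> to \<open>p\<close> is counted once.\<close>
  have split: "mset D = mset (R @ filter ?e D @ filter (\<lambda>x. \<not> ?e x) (filter ?s D))"
  proof (rule multiset_eqI)
    fix z
    show "count (mset D) z = count (mset (R @ filter ?e D @ filter (\<lambda>x. \<not> ?e x) (filter ?s D))) z"
      by (simp add: R_def)
  qed
  consider "a = p" "mset D = mset (R @ [(Arc p p c, v)])"
    | "a \<noteq> p" "mset D = mset (R @ [(Arc a p c, v), (Arc p b c, w)])"
  proof (cases "a = p")
    case True
    then have "y \<in> set (filter ?s D)" using ys y_eq by simp
    then have "y = x" using x by simp
    then show ?thesis using that(1) True split x y y_eq ys by simp
  next
    case False
    have "b \<noteq> p"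
    proof
      assume "b = p"
      then have "x \<in> set (filter ?e D)" using xs x_eq by simp
      then show False using y x_eq y_eq False by simp
    qed
    then show ?thesis using that(2) False split x y x_eq y_eq by simp
  qed
  then have "sources (join p D) = X \<and> targets (join p D) = Y \<and>
      occurrences (join p D) = occurrences D"
  proof cases
    case 1
    show ?thesis
      using sources_mset_cong[OF 1(2)] targets_mset_cong[OF 1(2)] occurrences_mset_cong[OF 1(2)] S T 1(1)
      by (simp add: join)
  next
    case 2
    show ?thesis
      using sources_mset_cong[OF 2(2)] targets_mset_cong[OF 2(2)] occurrences_mset_cong[OF 2(2)] S T 2(1)
      by (simp add: join add_mset_commute)
  qed
  then show "sources (join p D) = X" "targets (join p D) = Y"
    "occurrences (join p D) = occurrences D" by auto
qed

section \<open>Gluing and juxtaposition along boundary strands\<close>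

fun boundary_points :: "nat \<Rightarrow> bool \<Rightarrow> nat \<Rightarrow> strand list \<Rightarrow> (point \<times> nat) list" where
  "boundary_points h u k [] = []"
| "boundary_points h u k (x # xs) =
     (if snd x = u then [((h, k), fst x)] else []) @ boundary_points h u (Suc k) xs"

lemma boundary_points_append:
  "boundary_points h u k (xs @ ys) =
    boundary_points h u k xs @ boundary_points h u (k + length xs) ys"
  by (induction xs arbitrary: k) auto

lemma boundary_points_bounds:
  "y \<in> set (boundary_points h u k xs) \<Longrightarrow> fst (fst y) = h \<and> k \<le> snd (fst y)"
  by (induction xs arbitrary: k) (auto split: if_splits dest: Suc_leD)

lemma map_boundary_points:
  assumes "\<And>l. g (h, k + l) = (h', k' + l)"
  shows "map (map_prod g id) (boundary_points h u k xs) = boundary_points h' u k' xs"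
  using assms
proof (induction xs arbitrary: k k')
  case (Cons x xs)
  have "g (h, Suc k + l) = (h', Suc k' + l)" for l
    using Cons.prems[of "Suc l"] by simp
  with Cons.IH show ?case using Cons.prems[of 0] by simp
qed simp

lemma image_boundary_points:
  assumes "\<And>l. g (h, k + l) = (h', k' + l)"
  shows "image_mset (map_prod g id) (mset (boundary_points h u k xs)) =
    mset (boundary_points h' u k' xs)"
  by (simp only: mset_map[symmetric] map_boundary_points[where g = g, OF assms])

text \<open>At a glued point an upward strand ends the lower arc and starts the upper one, and a
  downward strand does the reverse. Either way the point is once a source and once a target, so both
  orientations appear in both multisets. Points still to be glued lie further right, and all others
  lie off level 1, so each gluing meets an isolated point.\<close>

lemma fold_join_invariants:
  assumes "sources D = X + mset (boundary_points 1 True k xs) + mset (boundary_points 1 False k xs)"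
    and "targets D = Y + mset (boundary_points 1 True k xs) + mset (boundary_points 1 False k xs)"
    and "\<And>y. y \<in># X + Y \<Longrightarrow> fst (fst y) \<noteq> 1"
  shows "sources (fold join (map (\<lambda>x. (1, x)) [k..<k + length xs]) D) = X \<and>
    targets (fold join (map (\<lambda>x. (1, x)) [k..<k + length xs]) D) = Y \<and>
    occurrences (fold join (map (\<lambda>x. (1, x)) [k..<k + length xs]) D) = occurrences D"
  using assms
proof (induction xs arbitrary: k D)
  case (Cons x xs)
  let ?X = "X + mset (boundary_points 1 True (Suc k) xs) + mset (boundary_points 1 False (Suc k) xs)"
    and ?Y = "Y + mset (boundary_points 1 True (Suc k) xs) + mset (boundary_points 1 False (Suc k) xs)"
  have S: "sources D = add_mset ((1, k), fst x) ?X" and T: "targets D = add_mset ((1, k), fst x) ?Y"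
    using Cons.prems by (cases "snd x"; simp)+
  have "fst y \<noteq> (1, k)" if "y \<in># ?X + ?Y" for y
    using that Cons.prems(3)[of y] boundary_points_bounds[of y 1 _ "Suc k" xs] by auto
  note join = join_invariants[OF S T this]
  have "[k..<k + length (x # xs)] = k # [Suc k..<Suc k + length xs]"
    by (simp add: upt_conv_Cons del: upt_Suc)
  then show ?case
    using Cons.IH[OF join(1,2) Cons.prems(3)] join(3) by simp
qed simp

text \<open>An upward strand starts at the bottom and ends at the top.\<close>

definition has_boundary :: "'l code \<Rightarrow> strand list \<Rightarrow> strand list \<Rightarrow> bool" where
  "has_boundary D B T \<longleftrightarrow>
     sources D = mset (boundary_points 0 True 0 B) + mset (boundary_points 1 False 0 T) \<and>
     targets D = mset (boundary_points 0 False 0 B) + mset (boundary_points 1 True 0 T)"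

lemma has_boundary_cong: "map fst D = map fst E \<Longrightarrow> has_boundary D B T = has_boundary E B T"
  by (simp only: has_boundary_def sources_conv targets_conv)

text \<open>The middle strands \<open>X\<close> are shared as a list, so points, orientations and
  colours match at level 1. The top of \<open>E\<close> waits at level 2 during the gluing and is
  then brought down to level 1.\<close>

lemma compose_invariants:
  assumes D: "has_boundary D B X" and E: "has_boundary E X T"
  shows "has_boundary (compose (length X) D E) B T"
    "occurrences (compose (length X) D E) = disjoint_sum (occurrences D) (occurrences E)"
proof -
  let ?F = "map_words left_names D @ move (\<lambda>(h, x). (h + 1, x)) (map_words right_names E)"
  let ?S = "mset (boundary_points 0 True 0 B) + mset (boundary_points 2 False 0 T)"
    and ?T = "mset (boundary_points 0 False 0 B) + mset (boundary_points 2 True 0 T)"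
  have up: "image_mset (map_prod (\<lambda>(h, x). (h + 1, x)) id) (mset (boundary_points h u 0 xs)) =
      mset (boundary_points (h + 1) u 0 xs)" for h u xs
    by (rule image_boundary_points) simp
  have "sources ?F = ?S + mset (boundary_points 1 True 0 X) + mset (boundary_points 1 False 0 X)"
    "targets ?F = ?T + mset (boundary_points 1 True 0 X) + mset (boundary_points 1 False 0 X)"
    using D E by (simp_all only: has_boundary_def sources_simps targets_simps sources_map_words
        targets_map_words sources_move targets_move image_mset_union up) (simp_all add: numeral_2_eq_2)
  moreover have "fst (fst y) \<noteq> 1" if "y \<in># ?S + ?T" for y
    using that boundary_points_bounds[of y 0 _ 0 B] boundary_points_bounds[of y 2 _ 0 T] by auto
  ultimately have *: "sources (fold join (map (\<lambda>x. (1, x)) [0..<length X]) ?F) = ?S"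
      "targets (fold join (map (\<lambda>x. (1, x)) [0..<length X]) ?F) = ?T"
      "occurrences (fold join (map (\<lambda>x. (1, x)) [0..<length X]) ?F) = occurrences ?F"
    using fold_join_invariants[of ?F ?S 0 X ?T] by simp_all
  have down: "image_mset (map_prod (\<lambda>(h, x). (if h = 0 then 0 else 1, x)) id)
      (mset (boundary_points h u 0 xs)) = mset (boundary_points (if h = 0 then 0 else 1) u 0 xs)"
    for h u xs
    by (rule image_boundary_points) simp
  show "has_boundary (compose (length X) D E) B T"
    unfolding has_boundary_def compose_def sources_move targets_move * image_mset_union down by simp
  show "occurrences (compose (length X) D E) = disjoint_sum (occurrences D) (occurrences E)"
    unfolding compose_def occurrences_move *
    by (simp add: occurrences_left_names occurrences_right_names disjoint_sum_def)
qed

lemma juxtapose_invariants: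
  assumes D: "has_boundary D B T" and E: "has_boundary E B' T'"
  shows "has_boundary (juxtapose (length B) (length T) D E) (B @ B') (T @ T')"
    "occurrences (juxtapose (length B) (length T) D E) =
      disjoint_sum (occurrences D) (occurrences E)"
proof -
  have right: "image_mset (map_prod (\<lambda>(h, x). (h, if h = 0 then length B + x else length T + x)) id)
      (mset (boundary_points h u 0 xs)) =
      mset (boundary_points h u (if h = 0 then length B else length T) xs)" for h u xs
    by (rule image_boundary_points) simp
  show "has_boundary (juxtapose (length B) (length T) D E) (B @ B') (T @ T')"
    using D E unfolding has_boundary_def juxtapose_def sources_simps targets_simps sources_move
      targets_move sources_map_words targets_map_words boundary_points_append
    by (simp add: right)
  show "occurrences (juxtapose (length B) (length T) D E) =
      disjoint_sum (occurrences D) (occurrences E)"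
    by (simp add: juxtapose_def occurrences_left_names occurrences_right_names disjoint_sum_def)
qed

section \<open>Underlying components under gluing\<close>

lemma fst_move: "map fst (move g D) = map (map_points g) (map fst D)"
  by (auto simp: move_def)

lemma fst_juxtapose_cong:
  "map fst D = map fst D' \<Longrightarrow> map fst E = map fst E' \<Longrightarrow>
    map fst (juxtapose b t D E) = map fst (juxtapose b t D' E')"
  by (simp only: juxtapose_def map_append fst_move fst_map_words)

text \<open>Gluing of components never consults the words. Hence all diagrams in the integral of a
  tangle have the components of its skeleton.\<close>

lemma fst_join:
  "map fst (join p D) =
    (case (filter (ends_at p) (map fst D), filter (starts_at p) (map fst D)) of
      ([Arc a b c], [Arc a' b' c']) \<Rightarrow>
        (if a = p then Circle c else Arc a b' c)
          # filter (\<lambda>s. \<not> ends_at p s \<and> \<not> starts_at p s) (map fst D)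
    | _ \<Rightarrow> map fst D)"
proof -
  have filter_fst: "filter P (map fst E) = map fst (filter (\<lambda>(s, w). P s) E)"
    for P and E :: diagram
    by (simp add: filter_map comp_def split_beta')
  define A where "A = filter (\<lambda>(s, w). ends_at p s) D"
  define B where "B = filter (\<lambda>(s, w). starts_at p s) D"
  define R where "R = filter (\<lambda>(s, w). \<not> ends_at p s \<and> \<not> starts_at p s) D"
  show ?thesis
    unfolding join_def filter_fst A_def[symmetric] B_def[symmetric] R_def[symmetric]
  proof (cases A)
    case (Cons y A1)
    obtain s v where y: "y = (s, v)" by fastforce
    show "map fst (case (A, B) of ([(Arc a b c, v)], [(Arc a' b' c', w)]) \<Rightarrow>
          (if a = p then (Circle c, v) else (Arc a b' c, v @ w)) # R | _ \<Rightarrow> D) =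
        (case (map fst A, map fst B) of ([Arc a b c], [Arc a' b' c']) \<Rightarrow>
          (if a = p then Circle c else Arc a b' c) # map fst R | _ \<Rightarrow> map fst D)"
    proof (cases B)
      case (Cons z B1)
      obtain t w where "z = (t, w)" by fastforce
      then show ?thesis
        using y Cons \<open>A = y # A1\<close> by (cases s; cases t; cases A1; cases B1; simp)
    qed (cases s; cases A1; simp add: y Cons)
  qed simp
qed

lemma fst_join_cong: "map fst D = map fst D' \<Longrightarrow> map fst (join p D) = map fst (join p D')"
  by (simp only: fst_join)

lemma fst_compose_cong:
  assumes "map fst D = map fst D'" "map fst E = map fst E'"
  shows "map fst (compose k D E) = map fst (compose k D' E')"
proof -
  have "map fst (fold join ps F) = map fst (fold join ps F')" if "map fst F = map fst F'" for ps F F'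
    using that
  proof (induction ps arbitrary: F F')
    case (Cons q ps)
    show ?case using Cons.IH[OF fst_join_cong[OF Cons.prems]] by simp
  qed simp
  from this[of "map_words left_names D @ move (\<lambda>(h, x). (h + 1, x)) (map_words right_names E)"
      "map_words left_names D' @ move (\<lambda>(h, x). (h + 1, x)) (map_words right_names E')"]
  show ?thesis
    by (simp only: compose_def map_append fst_move fst_map_words assms)
qed

lemma arc_simps [simp]:
  "source (fst (arc f p q c w)) = {#(if f then p else q, c)#}"
  "target (fst (arc f p q c w)) = {#(if f then q else p, c)#}"
  "colour (fst (arc f p q c w)) = c"
  "mset (snd (arc f p q c w)) = mset w"
  by (auto simp: arc_def)

section \<open>Chords of a given type in horizontal diagrams\<close>

text \<open>The degree is left out on purpose: with a fixed degree the functional would not be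
  multiplicative.\<close>

definition type_indicator :: "nat \<Rightarrow> nat \<Rightarrow> diagram \<Rightarrow> rat" where
  "type_indicator i j D = of_bool (only_type i j (occurrences D))"

lemma occurrence_type_word:
  "occurrence_type (image_mset (\<lambda>l. (l, c)) (mset w)) x = replicate_mset (count_list w x) c"
  by (simp only: occurrence_type_def replicate_count_list)

lemma horizontal_diagram_boundary: "has_boundary (horizontal_diagram xs cs) xs xs"
proof -
  let ?D = "\<lambda>n. map (\<lambda>k. arc (snd (xs ! k)) (0, k) (1, k) (fst (xs ! k))
    (filter (\<lambda>l. k = fst (cs ! l) \<or> k = snd (cs ! l)) [0..<length cs])) [0..<n]"
  have "has_boundary (?D n) (take n xs) (take n xs)" if "n \<le> length xs" for n
    using that
  proof (induction n)
    case 0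
    then show ?case by (simp add: has_boundary_def)
  next
    case (Suc n)
    then show ?case
      by (simp add: has_boundary_def take_Suc_conv_app_nth boundary_points_append)
  qed
  from this[of "length xs"] show ?thesis
    by (simp add: horizontal_diagram_def)
qed

text \<open>As \<open>p\<close> and \<open>q\<close> differ, the name \<open>l\<close> is recorded
  once on each of the two strands of its chord; were they equal, it would be recorded only once in
  all. The type is computed by adding the strands one at a time.\<close>

lemma horizontal_diagram_occurrences:
  assumes "\<And>p q. (p, q) \<in> set cs \<Longrightarrow> p \<noteq> q \<and> p < length xs \<and> q < length xs"
  shows "fst ` set_mset (occurrences (horizontal_diagram xs cs)) = {..<length cs}"
    "l < length cs \<Longrightarrow> occurrence_type (occurrences (horizontal_diagram xs cs)) l =
      {#fst (xs ! fst (cs ! l)), fst (xs ! snd (cs ! l))#}"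
proof -
  let ?w = "\<lambda>k. filter (\<lambda>l. k = fst (cs ! l) \<or> k = snd (cs ! l)) [0..<length cs]"
  let ?D = "\<lambda>n. map (\<lambda>k. arc (snd (xs ! k)) (0, k) (1, k) (fst (xs ! k)) (?w k)) [0..<n]"
  have type: "occurrence_type (occurrences (horizontal_diagram xs cs)) l =
      {#fst (xs ! fst (cs ! l)), fst (xs ! snd (cs ! l))#}" if l: "l < length cs" for l
  proof -
    obtain p q where pq: "cs ! l = (p, q)" by fastforce
    have ne: "p \<noteq> q" "p < length xs" "q < length xs"
      using assms[of p q] pq l nth_mem[OF l] by simp_all
    have count: "count_list (?w k) l = of_bool (k = p \<or> k = q)" for k
    proof -
      have "count (mset (?w k)) l = of_bool (k = p \<or> k = q)"
        using l pq by (simp add: count_mset_set')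
      then show ?thesis unfolding count_mset .
    qed
    have "occurrence_type (occurrences (?D n)) l =
        (if p < n then {#fst (xs ! p)#} else {#}) + (if q < n then {#fst (xs ! q)#} else {#})" for n
    proof (induction n)
      case 0
      then show ?case by (simp add: occurrence_type_def)
    next
      case (Suc n)
      have "occurrences (?D (Suc n)) =
          occurrences (?D n) + image_mset (\<lambda>l. (l, fst (xs ! n))) (mset (?w n))"
        by simp
      then have "occurrence_type (occurrences (?D (Suc n))) l =
          (if p < n then {#fst (xs ! p)#} else {#}) + (if q < n then {#fst (xs ! q)#} else {#}) +
          replicate_mset (of_bool (n = p \<or> n = q)) (fst (xs ! n))"
        by (simp only: occurrence_type_add occurrence_type_word count Suc.IH)
      then show ?case
        unfolding less_Suc_eq using ne(1) by auto
    qed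
    from this[of "length xs"] show ?thesis
      using ne pq by (simp add: horizontal_diagram_def)
  qed
  then show "l < length cs \<Longrightarrow> occurrence_type (occurrences (horizontal_diagram xs cs)) l =
      {#fst (xs ! fst (cs ! l)), fst (xs ! snd (cs ! l))#}" .
  have "fst ` set_mset (occurrences (?D n)) \<subseteq> {..<length cs}" for n
    by (induction n) auto
  then have "fst ` set_mset (occurrences (horizontal_diagram xs cs)) \<subseteq> {..<length cs}"
    unfolding horizontal_diagram_def .
  moreover have "l \<in> fst ` set_mset (occurrences (horizontal_diagram xs cs))" if "l < length cs" for l
  proof (rule ccontr)
    assume "l \<notin> fst ` set_mset (occurrences (horizontal_diagram xs cs))"
    from occurrence_type_empty[OF this] type[OF that] show False by simp
  qed
  ultimately show "fst ` set_mset (occurrences (horizontal_diagram xs cs)) = {..<length cs}"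
    by auto
qed

text \<open>The share of a single chord in the functional. A list of chords gets the product of its
  weights, whatever their order, which is why the associator is seen only at commuting
  variables.\<close>

fun pair_weight :: "nat \<Rightarrow> nat \<Rightarrow> strand list \<Rightarrow> nat \<times> nat \<Rightarrow> rat" where
  "pair_weight i j xs (p, q) = orientation_sign (xs ! p) * orientation_sign (xs ! q) *
     of_bool ({#fst (xs ! p), fst (xs ! q)#} = {#i, j#})"

lemma type_indicator_horizontal:
  assumes "\<And>p q. (p, q) \<in> set cs \<Longrightarrow> p \<noteq> q \<and> p < length xs \<and> q < length xs"
  shows "(\<Prod>(p, q)\<leftarrow>cs. orientation_sign (xs ! p) * orientation_sign (xs ! q)) *
    type_indicator i j (horizontal_diagram xs cs) = (\<Prod>e\<leftarrow>cs. pair_weight i j xs e)"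
proof -
  let ?t = "\<lambda>e. {#fst (xs ! fst e), fst (xs ! snd e)#} = {#i, j#}"
  have "only_type i j (occurrences (horizontal_diagram xs cs)) \<longleftrightarrow> (\<forall>l<length cs. ?t (cs ! l))"
  proof -
    have *: "fst ` set_mset (occurrences (horizontal_diagram xs cs)) = {..<length cs}"
      by (rule horizontal_diagram_occurrences(1)) (rule assms)
    have "occurrence_type (occurrences (horizontal_diagram xs cs)) l =
        {#fst (xs ! fst (cs ! l)), fst (xs ! snd (cs ! l))#}" if "l < length cs" for l
      by (rule horizontal_diagram_occurrences(2)[OF _ that]) (rule assms)
    then show ?thesis
      unfolding only_type_def * by (simp add: Ball_def)
  qed
  also have "\<dots> \<longleftrightarrow> (\<forall>e\<in>set cs. ?t e)"
    by (metis in_set_conv_nth)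
  finally have "type_indicator i j (horizontal_diagram xs cs) = of_bool (\<forall>e\<in>set cs. ?t e)"
    by (simp add: type_indicator_def)
  moreover have "(\<Prod>(p, q)\<leftarrow>cs'. orientation_sign (xs ! p) * orientation_sign (xs ! q)) *
      of_bool (\<forall>e\<in>set cs'. ?t e) = (\<Prod>e\<leftarrow>cs'. pair_weight i j xs e)" for cs'
  proof (induction cs')
    case (Cons e cs')
    obtain p q where e: "e = (p, q)" by fastforce
    show ?case
    proof (cases "?t e")
      case True
      then show ?thesis using Cons by (simp add: e)
    next
      case False
      then show ?thesis by (simp add: e)
    qed
  qed simp
  ultimately show ?thesis by simp
qed

section \<open>Series of horizontal chords and cabled associators\<close>

lemma keys_on_strandsE:
  assumes "D \<in> Poly_Mapping.keys (on_strands xs F d)"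
  obtains cs where "cs \<in> Poly_Mapping.keys (F d)" "D = horizontal_diagram xs cs"
  using assms unfolding on_strands_def by (auto dest!: keys_sum_elem keys_singleD)

lemma lin_on_strands:
  assumes "\<And>cs p q. cs \<in> Poly_Mapping.keys (F d) \<Longrightarrow> (p, q) \<in> set cs \<Longrightarrow>
    p \<noteq> q \<and> p < length xs \<and> q < length xs"
  shows "lin (type_indicator i j) (on_strands xs F d) =
    lin (\<lambda>cs. \<Prod>e\<leftarrow>cs. pair_weight i j xs e) (F d)"
proof -
  have "lin (type_indicator i j) (on_strands xs F d) =
      (\<Sum>cs\<in>Poly_Mapping.keys (F d). Poly_Mapping.lookup (F d) cs *
        ((\<Prod>(p, q)\<leftarrow>cs. orientation_sign (xs ! p) * orientation_sign (xs ! q)) *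
          type_indicator i j (horizontal_diagram xs cs)))"
    by (simp add: on_strands_def lin_sum mult.assoc)
  also have "\<dots> = lin (\<lambda>cs. \<Prod>e\<leftarrow>cs. pair_weight i j xs e) (F d)"
    unfolding lin_def using assms by (intro sum.cong refl arg_cong2[where f = "(*)"] type_indicator_horizontal)
  finally show ?thesis .
qed

lemma keys_cabled:
  assumes "cs \<in> Poly_Mapping.keys (cabled \<phi> U V W d)"
  shows "length cs = d" "set cs \<subseteq> U \<times> V \<union> V \<times> W"
  using assms unfolding cabled_def by (auto dest!: keys_sum_elem keys_singleD)

definition chord_series :: "(nat \<times> nat) set \<Rightarrow> (nat \<times> nat) list series \<Rightarrow> bool" where
  "chord_series S F \<longleftrightarrow> (\<forall>d. \<forall>cs\<in>Poly_Mapping.keys (F d). length cs = d \<and> set cs \<subseteq> S)"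

lemma chord_series_cabled: "U \<times> V \<union> V \<times> W \<subseteq> S \<Longrightarrow> chord_series S (cabled \<phi> U V W)"
  unfolding chord_series_def using keys_cabled by (metis subset_trans)

lemma chord_series_sprod:
  assumes "chord_series S F" "chord_series S G"
  shows "chord_series S (sprod (@) F G)"
  unfolding chord_series_def
proof (intro allI ballI)
  fix d cs assume "cs \<in> Poly_Mapping.keys (sprod (@) F G d)"
  then obtain a x y where "a \<le> d" "x \<in> Poly_Mapping.keys (F a)" "y \<in> Poly_Mapping.keys (G (d - a))"
      "cs = x @ y"
    by (rule keys_sprodE)
  then show "length cs = d \<and> set cs \<subseteq> S"
    using assms by (auto simp: chord_series_def)
qed

lemma lin_cabled:
  assumes "finite U" "finite V" "finite W"
  shows "lin (\<lambda>cs. \<Prod>e\<leftarrow>cs. wt e) (cabled \<phi> U V W d) =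
    commutative_value \<phi>
      (\<lambda>b. \<Sum>e | e \<in> U \<times> V \<union> V \<times> W \<and> (case e of (p, q) \<Rightarrow> p \<in> V) = b. wt e) d"
  unfolding cabled_def lin_sum lin_single
  by (rule sum_lists_marked) (use assms in auto)

lemma lin_cabled_0: "lin (\<lambda>cs. \<Prod>e\<leftarrow>cs. wt e) (cabled \<phi> U V W 0) = \<phi> []"
proof -
  have "{cs. cs = [] \<and> set cs \<subseteq> U \<times> V \<union> V \<times> W} = {[]}" by auto
  then show ?thesis by (simp add: cabled_def lin_sum)
qed

lemma lin_cabled_1:
  assumes "finite U" "finite V" "finite W" "U \<inter> V = {}"
  shows "lin (\<lambda>cs. \<Prod>e\<leftarrow>cs. wt e) (cabled \<phi> U V W 1) =
    \<phi> [False] * (\<Sum>p\<in>U. \<Sum>q\<in>V. wt (p, q)) + \<phi> [True] * (\<Sum>p\<in>V. \<Sum>q\<in>W. wt (p, q))"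
proof -
  have 1: "{w :: bool list. length w = 1} = {[False], [True]}"
    by (auto simp: length_Suc_conv)
  define \<gamma> where "\<gamma> b = (\<Sum>e | e \<in> U \<times> V \<union> V \<times> W \<and> (case e of (p, q) \<Rightarrow> p \<in> V) = b. wt e)" for b
  \<comment> \<open>Disjointness of \<open>U\<close> and \<open>V\<close> makes the mark
    \<open>p \<in> V\<close> tell the two kinds of chords apart.\<close>
  have 2: "{e. e \<in> U \<times> V \<union> V \<times> W \<and> (case e of (p, q) \<Rightarrow> p \<in> V) = False} = U \<times> V"
    "{e. e \<in> U \<times> V \<union> V \<times> W \<and> (case e of (p, q) \<Rightarrow> p \<in> V) = True} = V \<times> W"
    using assms(4) by auto
  have "\<gamma> False = (\<Sum>p\<in>U. \<Sum>q\<in>V. wt (p, q))" "\<gamma> True = (\<Sum>p\<in>V. \<Sum>q\<in>W. wt (p, q))"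
    unfolding \<gamma>_def 2 by (simp_all add: sum.cartesian_product case_prod_beta')
  then show ?thesis
    unfolding lin_cabled[OF assms(1-3)] commutative_value_def 1 \<gamma>_def[symmetric] by simp
qed

lemma pair_mset_eq: "{#a, b#} = {#c, d#} \<longleftrightarrow> a = c \<and> b = d \<or> a = d \<and> b = c"
  by (auto simp: add_eq_conv_ex)

section \<open>The linear part of an associator\<close>

text \<open>The bridge between the functional known to vanish on relations and the multiplicative
  one. The degree is required only of diagrams that pass the type test.\<close>

lemma lin_mixed_eq_type_indicator:
  assumes "\<And>D. D \<in> Poly_Mapping.keys f \<Longrightarrow> P (mset (map fst D))"
    "\<And>D. D \<in> Poly_Mapping.keys f \<Longrightarrow> only_type i j (occurrences D) \<Longrightarrow> degree D = n"
  shows "lin (mixed_indicator P i j n) f = lin (type_indicator i j) f"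
  using assms by (intro lin_cong) (auto simp: mixed_indicator_def type_indicator_def)

text \<open>Compare chords of one type on four strands of different colours. The chord 01 occurs in
  one factor on the first side of the pentagon and in two on the second, so \<phi>[False] equals its
  double; the chord 23 does the same for \<phi>[True].\<close>

lemma associator_linear_part:
  assumes "group_like \<phi>" "pentagon \<phi>"
  shows "\<phi> [False] = 0" "\<phi> [True] = 0"
proof -
  have [simp]: "\<phi> [] = 1"
    using assms(1) unfolding group_like_def by (rule conjunct1)
  let ?F = "sprod (@) (cabled \<phi> {0, 1} {2} {3}) (cabled \<phi> {0} {1} {2, 3})"
  let ?G = "sprod (@) (cabled \<phi> {0} {1} {2})
      (sprod (@) (cabled \<phi> {0} {1, 2} {3}) (cabled \<phi> {1} {2} {3}))"
  have upward: "upward 4 = [(0, True), (1, True), (2, True), (3, True)]"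
    by (simp add: upward_def numeral_eq_Suc)
  let ?S = "{(p, q). p \<noteq> q \<and> p < length (upward 4) \<and> q < length (upward 4)}"
  have F: "chord_series ?S ?F" and G: "chord_series ?S ?G"
    by (intro chord_series_sprod chord_series_cabled; force simp: upward)+
  have value_1: "lin (mixed_indicator (\<lambda>_. True) i j 1) (on_strands (upward 4) H 1) =
      lin (\<lambda>cs. \<Prod>e\<leftarrow>cs. pair_weight i j (upward 4) e) (H 1)"
    if H: "chord_series ?S H" for H i j
  proof -
    have valid: "p \<noteq> q \<and> p < length (upward 4) \<and> q < length (upward 4)"
      if "cs \<in> Poly_Mapping.keys (H 1)" "(p, q) \<in> set cs" for cs p q
    proof -
      from H that(1) have "set cs \<subseteq> ?S" unfolding chord_series_def by blast
      with that(2) show ?thesis by blast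
    qed
    have "degree D = 1" if D: "D \<in> Poly_Mapping.keys (on_strands (upward 4) H 1)" for D
    proof -
      obtain cs where cs: "cs \<in> Poly_Mapping.keys (H 1)" "D = horizontal_diagram (upward 4) cs"
        using D by (rule keys_on_strandsE)
      have "length cs = 1" using H cs(1) unfolding chord_series_def by blast
      moreover have "fst ` set_mset (occurrences D) = {..<length cs}"
        unfolding cs(2) by (rule horizontal_diagram_occurrences(1)) (rule valid[OF cs(1)])
      ultimately show ?thesis
        by (simp add: degree_occurrences)
    qed
    then have "lin (mixed_indicator (\<lambda>_. True) i j 1) (on_strands (upward 4) H 1) =
        lin (type_indicator i j) (on_strands (upward 4) H 1)"
      by (intro lin_mixed_eq_type_indicator) auto
    also have "\<dots> = lin (\<lambda>cs. \<Prod>e\<leftarrow>cs. pair_weight i j (upward 4) e) (H 1)"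
      by (rule lin_on_strands) (rule valid)
    finally show ?thesis .
  qed
  have *: "lin (\<lambda>cs. \<Prod>e\<leftarrow>cs. pair_weight i j (upward 4) e) (?F 1) =
      lin (\<lambda>cs. \<Prod>e\<leftarrow>cs. pair_weight i j (upward 4) e) (?G 1)" for i j
    using assms(2) lin_equal_mod_4T[of "on_strands (upward 4) ?F" "on_strands (upward 4) ?G" "\<lambda>_. True" i j 1 1]
    unfolding pentagon_def value_1[OF F] value_1[OF G] by blast
  \<comment> \<open>Constant terms are 1, so in degree 1 the linear parts of the factors add
    up.\<close>
  have mult: "lin (\<lambda>cs. \<Prod>e\<leftarrow>cs. wt e) (sprod (@) S T d) =
      (\<Sum>a\<le>d. lin (\<lambda>cs. \<Prod>e\<leftarrow>cs. wt e) (S a) * lin (\<lambda>cs. \<Prod>e\<leftarrow>cs. wt e) (T (d - a)))"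
    for wt :: "nat \<times> nat \<Rightarrow> rat" and S T d
    by (rule lin_sprod) simp
  have upto: "{..1} = {0, 1 :: nat}" "{..0} = {0 :: nat}" by auto
  show "\<phi> [False] = 0"
    using *[of 0 1] unfolding mult upto
    by (simp add: lin_cabled_0 lin_cabled_1[unfolded One_nat_def] mult upto upward
        orientation_sign_def pair_mset_eq)
  show "\<phi> [True] = 0"
    using *[of 2 3] unfolding mult upto
    by (simp add: lin_cabled_0 lin_cabled_1[unfolded One_nat_def] mult upto upward
        orientation_sign_def pair_mset_eq)
qed

lemma nc_inverse_Nil: "nc_inverse \<phi> [] = 1" by (subst nc_inverse.simps) simp

lemma commutative_value_associator:
  assumes g: "group_like \<phi>" and lp: "\<phi> [False] = 0" "\<phi> [True] = 0"
  shows "commutative_value (if e then \<phi> else nc_inverse \<phi>) \<gamma> d = of_bool (d = 0)"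
proof (cases "d = 0")
  case True
  have 1: "\<phi> [] = 1" using g unfolding group_like_def by (rule conjunct1)
  have "commutative_value (if e then \<phi> else nc_inverse \<phi>) \<gamma> 0 = 1"
    unfolding commutative_value_0 using 1 nc_inverse_Nil[of \<phi>] by (cases e) (simp_all only: if_True if_False)
  then show ?thesis by (simp only: True) simp
next
  case False
  have 3: "commutative_value \<phi> \<gamma> k = 0" if "k > 0" for k
    by (rule commutative_value_group_like[OF g lp that])
  have "d > 0" using False by simp
  have 4: "commutative_value (nc_inverse \<phi>) \<gamma> d = 0"
    by (rule commutative_value_inverse[OF _ \<open>d > 0\<close>]) (rule 3)
  show ?thesis
    using 3[OF \<open>d > 0\<close>] 4 False by (cases e) (simp_all only: if_True if_False of_bool_eq(1))
qed

section \<open>Values on elementary tangles\<close>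

lemma type_indicator_disjoint_sum:
  "occurrences F = disjoint_sum (occurrences D) (occurrences E) \<Longrightarrow>
    type_indicator i j F = type_indicator i j D * type_indicator i j E"
  by (simp add: type_indicator_def only_type_disjoint_sum)

lemma crossing_diagram_occurrences:
  "occurrences (crossing_diagram x y w) =
    image_mset (\<lambda>l. (l, fst x)) (mset w) + image_mset (\<lambda>l. (l, fst y)) (mset w)"
  by (simp add: crossing_diagram_def)

text \<open>The parallel chords all have the same type. Without chords the condition is vacuous,
  which leaves the constant term 1 at a crossing of any other components.\<close>

lemma only_type_crossing:
  "only_type i j (occurrences (crossing_diagram x y [0..<k])) \<longleftrightarrow>
    k = 0 \<or> {#fst x, fst y#} = {#i, j#}"
proof -
  have letters: "fst ` set_mset (occurrences (crossing_diagram x y [0..<k])) = {..<k}"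
    by (force simp: crossing_diagram_occurrences)
  have "occurrence_type (occurrences (crossing_diagram x y [0..<k])) l = {#fst x, fst y#}"
    if "l < k" for l
  proof -
    have "count (mset [0..<k]) l = 1" using that by simp
    then have "count_list [0..<k] l = 1" unfolding count_mset .
    then show ?thesis
      by (simp only: crossing_diagram_occurrences occurrence_type_add occurrence_type_word) simp
  qed
  then show ?thesis
    unfolding only_type_def letters by (cases "k = 0") (auto simp: Ball_def)
qed

lemma degree_crossing: "degree (crossing_diagram x y [0..<k]) = k"
proof -
  have "fst ` set_mset (occurrences (crossing_diagram x y [0..<k])) = {..<k}"
    by (force simp: crossing_diagram_occurrences)
  then show ?thesis by (simp add: degree_occurrences)
qed

text \<open>The type of a chord on one colour repeats that colour and cannot contain both
  \<open>i\<close> and \<open>j\<close>. The word is arbitrary, so of \<nu> one has to know only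
  that its words in positive degree are nonempty.\<close>

lemma not_only_type_one_colour:
  assumes "w \<noteq> []" "i \<noteq> j" "occurrences D = image_mset (\<lambda>l. (l, c)) (mset w)"
  shows "\<not> only_type i j (occurrences D)"
proof
  assume *: "only_type i j (occurrences D)"
  obtain x where "x \<in> set w" using assms(1) by (cases w) auto
  then have "x \<in> fst ` set_mset (occurrences D)"
    by (force simp: assms(3))
  then have "replicate_mset (count_list w x) c = {#i, j#}"
    using * unfolding only_type_def assms(3) occurrence_type_word by blast
  then have "i \<in># replicate_mset (count_list w x) c" "j \<in># replicate_mset (count_list w x) c"
    by simp_all
  then show False using assms(2) by (simp split: if_splits)
qed

section \<open>Words of \<nu> and of its square root in positive degree\<close>

lemma keys_resolve_nonempty:
  assumes "w' \<in> Poly_Mapping.keys (resolve k w vs)" "w \<noteq> []"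
  shows "w' \<noteq> []"
  using assms
proof (induction k arbitrary: w vs)
  case (Suc k)
  \<comment> \<open>Whichever vertex is resolved, both resulting words contain the two new letters
    \<open>x\<close> and \<open>y\<close>; nothing else about the STU step is retained.\<close>
  obtain u v x y vs' where "resolve (Suc k) w vs = resolve k (u @ [x, y] @ v) vs' - resolve k (u @ [y, x] @ v) vs'"
    by (simp add: Let_def split_beta)
  then have "w' \<in> Poly_Mapping.keys (resolve k (u @ [x, y] @ v) vs') \<union>
      Poly_Mapping.keys (resolve k (u @ [y, x] @ v) vs')"
    using Suc.prems(1) keys_diff by fastforce
  then show ?case using Suc.IH by auto
qed simp

lemma keys_nu_nonempty:
  assumes "w \<in> Poly_Mapping.keys (nu d)" "d > 0"
  shows "w \<noteq> []"
proof -
  obtain ns where "w \<in> Poly_Mapping.keys (\<Sum>u\<in>permutations_of_set {..<d}. resolve d u (wheels d 0 ns))"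
    using assms(1) keys_scale unfolding nu_def by (meson keys_sum_elem subsetD)
  then obtain u where u: "u \<in> permutations_of_set {..<d}"
      "w \<in> Poly_Mapping.keys (resolve d u (wheels d 0 ns))"
    by (meson keys_sum_elem)
  have "u \<noteq> []"
    using permutations_of_setD(1)[OF u(1)] assms(2) by fastforce
  with u(2) show ?thesis by (rule keys_resolve_nonempty)
qed

lemma keys_line_power_nonempty:
  assumes "\<And>d w. d > 0 \<Longrightarrow> w \<in> Poly_Mapping.keys (F d) \<Longrightarrow> w \<noteq> []"
    and "w \<in> Poly_Mapping.keys (line_power F k d)" "d > 0"
  shows "w \<noteq> []"
  using assms(2,3)
proof (induction k arbitrary: d w)
  case 0
  then show ?case by (simp add: sone_def)
next
  case (Suc k)
  from Suc.prems(1) have "w \<in> Poly_Mapping.keys (sprod line_mult F (line_power F k) d)" by simp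
  then obtain a x y where *: "a \<le> d" "x \<in> Poly_Mapping.keys (F a)"
      "y \<in> Poly_Mapping.keys (line_power F k (d - a))" "w = line_mult x y"
    by (rule keys_sprodE)
  have "x \<noteq> [] \<or> y \<noteq> []"
  proof (cases "a = 0")
    case True
    then show ?thesis using Suc.IH[of y d] *(3) Suc.prems(2) by simp
  next
    case False
    then show ?thesis using assms(1)[of a x] *(2) by simp
  qed
  then show ?case using *(4) by (auto simp: line_mult_def left_names_def right_names_def)
qed

lemma keys_sqrt_nu_nonempty:
  assumes "w \<in> Poly_Mapping.keys (sqrt_nu d)" "d > 0"
  shows "w \<noteq> []"
proof -
  obtain k where k: "w \<in> Poly_Mapping.keys (line_power (\<lambda>e. nu e - sone [] e) k d)"
    using assms(1) keys_scale unfolding sqrt_nu_def by (meson keys_sum_elem subsetD)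
  have "u \<noteq> []" if "e > 0" "u \<in> Poly_Mapping.keys (nu e - sone [] e)" for e u
    using that keys_nu_nonempty[of u e] by (simp add: sone_def)
  then show ?thesis
    by (rule keys_line_power_nonempty[OF _ k assms(2)])
qed

lemma sqrt_nu_0: "sqrt_nu 0 = Poly_Mapping.single [] 1"
proof -
  have "scale 1 f = f" for f :: "'a \<Rightarrow>\<^sub>0 rat"
    by (rule poly_mapping_eqI) (simp add: lookup_scale)
  then show ?thesis by (simp add: sqrt_nu_def sone_def)
qed

lemma keys_on_wordE:
  assumes "D \<in> Poly_Mapping.keys (on_word g F d)"
  obtains w where "w \<in> Poly_Mapping.keys (F d)" "D = g w"
  using assms unfolding on_word_def by (auto dest!: keys_sum_elem keys_singleD)

lemma lin_on_word: "lin h (on_word g F d) = lin (h \<circ> g) (F d)"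
  by (simp add: on_word_def lin_sum) (simp add: lin_def)

text \<open>A word passing the type test must be empty, and empty words occur only in degree 0. This
  settles the degree without counting the chords that STU produces.\<close>

lemma sqrt_nu_one_colour:
  assumes "i \<noteq> j" and g: "\<And>w. occurrences (g w) = image_mset (\<lambda>l. (l, c)) (mset w)"
  shows "lin (type_indicator i j) (on_word g sqrt_nu d) = of_bool (d = 0)"
    and "D \<in> Poly_Mapping.keys (on_word g sqrt_nu d) \<Longrightarrow> only_type i j (occurrences D) \<Longrightarrow>
      degree D = d"
proof -
  show "lin (type_indicator i j) (on_word g sqrt_nu d) = of_bool (d = 0)"
  proof (cases "d = 0")
    case True
    then show ?thesis by (simp add: lin_on_word sqrt_nu_0 type_indicator_def g)
  next
    case False
    have "type_indicator i j (g w) = 0" if "w \<in> Poly_Mapping.keys (sqrt_nu d)" for w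
      using not_only_type_one_colour[OF keys_sqrt_nu_nonempty[OF that] assms(1) g] False
      by (simp add: type_indicator_def)
    then have "lin (type_indicator i j \<circ> g) (sqrt_nu d) = 0"
      by (simp add: lin_def)
    then show ?thesis using False by (simp add: lin_on_word)
  qed
next
  assume D: "D \<in> Poly_Mapping.keys (on_word g sqrt_nu d)" and *: "only_type i j (occurrences D)"
  from D obtain w where w: "w \<in> Poly_Mapping.keys (sqrt_nu d)" "D = g w"
    by (rule keys_on_wordE)
  have "w = []"
    using not_only_type_one_colour[of w i j "g w" c] * g assms(1) w(2) by blast
  moreover from this have "d = 0"
    using keys_sqrt_nu_nonempty[OF w(1)] by blast
  ultimately show "degree D = d"
    by (simp add: w(2) degree_occurrences g)
qed

section \<open>The functional on the Kontsevich integral\<close>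

definition strands :: "boundary \<Rightarrow> strand list" where
  "strands b = (case b of None \<Rightarrow> [] | Some u \<Rightarrow> points u)"

lemma strands_simps [simp]: "strands None = []" "strands (Some u) = points u"
  by (auto simp: strands_def)

lemma width_eq: "width b = length (strands b)"
  by (auto simp: width_def strands_def split: option.splits)

lemma strands_juxt [simp]: "strands (juxt_boundary a b) = strands a @ strands b"
  by (cases "(a, b)" rule: juxt_boundary.cases) auto

lemma skeleton_boundary:
  "well_formed t \<Longrightarrow> has_boundary (skeleton t) (strands (bottom t)) (strands (top t))"
proof (induction t)
  case (Strand x)
  then show ?case using horizontal_diagram_boundary[of "[x]"] by simp
next
  case (Crossing e x y)
  show ?case by (simp add: has_boundary_def crossing_diagram_def)
next
  case (Cap x)
  show ?case by (cases x) (simp add: has_boundary_def cap_diagram_def)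
next
  case (Cup x)
  show ?case by (cases x) (simp add: has_boundary_def cup_diagram_def)
next
  case (Reparenthesize e u v w)
  show ?case using horizontal_diagram_boundary[of "points u @ points v @ points w"] by simp
next
  case (Compose s t)
  then show ?case
    using compose_invariants(1)[of "skeleton s" "strands (bottom s)" "strands (top s)" "skeleton t"]
    by (simp add: width_eq)
next
  case (Juxtapose s t)
  then show ?case
    using juxtapose_invariants(1)[of "skeleton s" _ _ "skeleton t"] by (simp add: width_eq)
qed

text \<open>The degree \<open>d\<close> part of exp(xh) exp(yh) = exp((x+y)h), which matches
  products of tangles with the additivity of \<open>crossing_sum\<close>.\<close>

lemma binomial_divided_powers:
  fixes x y :: rat
  shows "(\<Sum>a\<le>d. x ^ a / fact a * (y ^ (d - a) / fact (d - a))) = (x + y) ^ d / fact d"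
proof -
  have "(x + y) ^ d / fact d = (\<Sum>a\<le>d. of_nat (d choose a) * x ^ a * y ^ (d - a) / fact d)"
    by (simp add: binomial_ring sum_divide_distrib)
  also have "\<dots> = (\<Sum>a\<le>d. x ^ a / fact a * (y ^ (d - a) / fact (d - a)))"
    by (intro sum.cong refl) (simp add: binomial_fact)
  finally show ?thesis ..
qed

lemma keys_cabled_points:
  assumes "cs \<in> Poly_Mapping.keys (cabled \<phi> {..<a} {a..<a + b} {a + b..<a + b + c} d)"
    and "(p, q) \<in> set cs"
  shows "p \<noteq> q \<and> p < a + (b + c) \<and> q < a + (b + c)"
proof -
  have "(p, q) \<in> {..<a} \<times> {a..<a + b} \<union> {a..<a + b} \<times> {a + b..<a + b + c}"
    using keys_cabled(2)[OF assms(1)] assms(2) by blast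
  then show ?thesis by auto
qed

text \<open>The components give the boundary, so that gluing preserves the chords. The degree is
  claimed only under the type test because that is all that is established for caps and cups; the
  test passes to both factors of a product, so the induction goes through.\<close>

lemma keys_Z:
  assumes "well_formed t" "i \<noteq> j" "D \<in> Poly_Mapping.keys (Z \<phi> t d)"
  shows "map fst D = map fst (skeleton t) \<and> (only_type i j (occurrences D) \<longrightarrow> degree D = d)"
  using assms(1,3)
proof (induction t arbitrary: d D)
  case (Strand x)
  then have "D = horizontal_diagram [x] []" "d = 0"
    by (auto simp: sone_def split: if_splits)
  then show ?case
    by (simp add: degree_occurrences horizontal_diagram_def)
next
  case (Crossing e x y)
  then have "D = crossing_diagram x y [0..<d]" by (simp split: if_splits)
  then show ?case by (simp add: degree_crossing) (simp add: crossing_diagram_def arc_def)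
next
  case (Cap x)
  then have D: "D \<in> Poly_Mapping.keys (on_word (cap_diagram x) sqrt_nu d)" by simp
  have "only_type i j (occurrences D) \<longrightarrow> degree D = d"
    using sqrt_nu_one_colour(2)[OF assms(2) _ D, of "fst x"] by (simp add: cap_diagram_def)
  moreover obtain w where "D = cap_diagram x w" using D by (rule keys_on_wordE)
  ultimately show ?case by (simp add: cap_diagram_def arc_def)
next
  case (Cup x)
  then have D: "D \<in> Poly_Mapping.keys (on_word (cup_diagram x) sqrt_nu d)" by simp
  have "only_type i j (occurrences D) \<longrightarrow> degree D = d"
    using sqrt_nu_one_colour(2)[OF assms(2) _ D, of "fst x"] by (simp add: cup_diagram_def)
  moreover obtain w where "D = cup_diagram x w" using D by (rule keys_on_wordE)
  ultimately show ?case by (simp add: cup_diagram_def arc_def)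
next
  case (Reparenthesize e u v w)
  let ?xs = "points u @ points v @ points w"
  let ?C = "cabled (if e then \<phi> else nc_inverse \<phi>) {..<length (points u)}
    {length (points u)..<length (points u) + length (points v)}
    {length (points u) + length (points v)..<length (points u) + length (points v) + length (points w)}"
  have "D \<in> Poly_Mapping.keys (on_strands ?xs ?C d)"
    using Reparenthesize by (simp only: Z.simps Let_def)
  then obtain cs where cs: "cs \<in> Poly_Mapping.keys (?C d)" "D = horizontal_diagram ?xs cs"
    by (rule keys_on_strandsE)
  have "fst ` set_mset (occurrences D) = {..<length cs}"
    unfolding cs(2) using keys_cabled_points[OF cs(1)]
    by (intro horizontal_diagram_occurrences(1)) simp
  then have "degree D = d"
    using keys_cabled(1)[OF cs(1)] by (simp add: degree_occurrences)
  moreover have "map fst D = map fst (horizontal_diagram ?xs [])"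
    unfolding cs(2) horizontal_diagram_def by (auto simp: arc_def)
  ultimately show ?case by simp
next
  case (Compose s t)
  have wf: "well_formed s" "well_formed t" "top s = bottom t" using Compose.prems(1) by auto
  from Compose.prems(2)
  have "D \<in> Poly_Mapping.keys (sprod (compose (width (top s))) (Z \<phi> s) (Z \<phi> t) d)" by simp
  then obtain a x y where D: "a \<le> d" "x \<in> Poly_Mapping.keys (Z \<phi> s a)"
      "y \<in> Poly_Mapping.keys (Z \<phi> t (d - a))" "D = compose (width (top s)) x y"
    by (rule keys_sprodE)
  note x = Compose.IH(1)[OF wf(1) D(2)] and y = Compose.IH(2)[OF wf(2) D(3)]
  have "has_boundary x (strands (bottom s)) (strands (top s))"
      "has_boundary y (strands (top s)) (strands (top t))"
    using skeleton_boundary[OF wf(1)] skeleton_boundary[OF wf(2)] x y wf(3)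
      has_boundary_cong[of x "skeleton s"] has_boundary_cong[of y "skeleton t"] by simp_all
  then have "occurrences D = disjoint_sum (occurrences x) (occurrences y)"
    unfolding D(4) width_eq by (rule compose_invariants(2))
  moreover have "map fst D = map fst (skeleton (Compose s t))"
    using fst_compose_cong[of x "skeleton s" y "skeleton t"] x y by (simp add: D(4))
  ultimately show ?case
    using x y D(1) by (simp add: only_type_disjoint_sum degree_occurrences card_disjoint_sum)
next
  case (Juxtapose s t)
  have wf: "well_formed s" "well_formed t" using Juxtapose.prems(1) by auto
  from Juxtapose.prems(2) have "D \<in> Poly_Mapping.keys
      (sprod (juxtapose (width (bottom s)) (width (top s))) (Z \<phi> s) (Z \<phi> t) d)" by simp
  then obtain a x y where D: "a \<le> d" "x \<in> Poly_Mapping.keys (Z \<phi> s a)"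
      "y \<in> Poly_Mapping.keys (Z \<phi> t (d - a))"
      "D = juxtapose (width (bottom s)) (width (top s)) x y"
    by (rule keys_sprodE)
  note x = Juxtapose.IH(1)[OF wf(1) D(2)] and y = Juxtapose.IH(2)[OF wf(2) D(3)]
  have "has_boundary x (strands (bottom s)) (strands (top s))"
      "has_boundary y (strands (bottom t)) (strands (top t))"
    using skeleton_boundary[OF wf(1)] skeleton_boundary[OF wf(2)] x y
      has_boundary_cong[of x "skeleton s"] has_boundary_cong[of y "skeleton t"] by simp_all
  then have "occurrences D = disjoint_sum (occurrences x) (occurrences y)"
    unfolding D(4) width_eq by (rule juxtapose_invariants(2))
  moreover have "map fst D = map fst (skeleton (Juxtapose s t))"
    using fst_juxtapose_cong[of x "skeleton s" y "skeleton t"] x y by (simp add: D(4))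
  ultimately show ?case
    using x y D(1) by (simp add: only_type_disjoint_sum degree_occurrences card_disjoint_sum)
qed

lemma keys_Z_boundary:
  assumes "well_formed t" "D \<in> Poly_Mapping.keys (Z \<phi> t d)"
  shows "has_boundary D (strands (bottom t)) (strands (top t))"
  \<comment> \<open>The colours 0 and 1 are an arbitrary distinct pair: the components do not depend
    on it.\<close>
  using skeleton_boundary[OF assms(1)] keys_Z[OF assms(1) zero_neq_one assms(2)]
    has_boundary_cong[of D "skeleton t"] by simp

text \<open>Stated for all tangles so that it can be proved on elementary pieces. A piece without
  relevant crossings has value \<open>0 ^ d / fact d\<close>, which is 1 in degree 0 and 0 in the
  others.\<close>

lemma lin_Z:
  assumes "well_formed t" "i \<noteq> j" "group_like \<phi>" "pentagon \<phi>"
  shows "lin (type_indicator i j) (Z \<phi> t d) = (crossing_sum i j t / 2) ^ d / fact d"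
  using assms(1)
proof (induction t arbitrary: d)
  case (Strand x)
  show ?case
    by (simp add: sone_def type_indicator_def horizontal_diagram_def)
next
  case (Crossing e x y)
  show ?case
    by (simp add: type_indicator_def only_type_crossing power_mult_distrib power_divide)
next
  case (Cap x)
  have "lin (type_indicator i j) (on_word (cap_diagram x) sqrt_nu d) = of_bool (d = 0)"
    by (rule sqrt_nu_one_colour(1)[OF assms(2), of _ "fst x"]) (simp add: cap_diagram_def)
  then show ?case by simp
next
  case (Cup x)
  have "lin (type_indicator i j) (on_word (cup_diagram x) sqrt_nu d) = of_bool (d = 0)"
    by (rule sqrt_nu_one_colour(1)[OF assms(2), of _ "fst x"]) (simp add: cup_diagram_def)
  then show ?case by simp
next
  case (Reparenthesize e u v w)
  let ?xs = "points u @ points v @ points w"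
  let ?C = "cabled (if e then \<phi> else nc_inverse \<phi>) {..<length (points u)}
    {length (points u)..<length (points u) + length (points v)}
    {length (points u) + length (points v)..<length (points u) + length (points v) + length (points w)}"
  have "lin (type_indicator i j) (Z \<phi> (Reparenthesize e u v w) d) =
      lin (type_indicator i j) (on_strands ?xs ?C d)"
    by (simp only: Z.simps Let_def)
  also have "\<dots> = lin (\<lambda>cs. \<Prod>e\<leftarrow>cs. pair_weight i j ?xs e) (?C d)"
  proof (rule lin_on_strands)
    fix cs p q assume "cs \<in> Poly_Mapping.keys (?C d)" "(p, q) \<in> set cs"
    from keys_cabled_points[OF this] show "p \<noteq> q \<and> p < length ?xs \<and> q < length ?xs" by simp
  qed
  also have "\<dots> = of_bool (d = 0)"
    by (subst lin_cabled) (simp_all only: finite_lessThan finite_atLeastLessThan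
        commutative_value_associator[OF assms(3) associator_linear_part[OF assms(3,4)]])
  finally show ?case by simp
next
  case (Compose s t)
  then have wf: "well_formed s" "well_formed t" "top s = bottom t" by auto
  have "type_indicator i j (compose (width (top s)) x y) = type_indicator i j x * type_indicator i j y"
    if "x \<in> Poly_Mapping.keys (Z \<phi> s a)" "y \<in> Poly_Mapping.keys (Z \<phi> t b)" for a b x y
    unfolding width_eq
    by (rule type_indicator_disjoint_sum, rule compose_invariants(2)[OF keys_Z_boundary[OF wf(1) that(1)]])
      (use keys_Z_boundary[OF wf(2) that(2)] wf(3) in simp)
  then have "lin (type_indicator i j) (Z \<phi> (Compose s t) d) =
      (\<Sum>a\<le>d. lin (type_indicator i j) (Z \<phi> s a) * lin (type_indicator i j) (Z \<phi> t (d - a)))"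
    unfolding Z.simps by (intro lin_sprod)
  then show ?case
    by (simp only: Compose.IH(1)[OF wf(1)] Compose.IH(2)[OF wf(2)] binomial_divided_powers
        crossing_sum.simps add_divide_distrib)
next
  case (Juxtapose s t)
  then have wf: "well_formed s" "well_formed t" by auto
  have "type_indicator i j (juxtapose (width (bottom s)) (width (top s)) x y) =
      type_indicator i j x * type_indicator i j y"
    if "x \<in> Poly_Mapping.keys (Z \<phi> s a)" "y \<in> Poly_Mapping.keys (Z \<phi> t b)" for a b x y
    unfolding width_eq
    by (rule type_indicator_disjoint_sum, rule juxtapose_invariants(2)[OF
        keys_Z_boundary[OF wf(1) that(1)] keys_Z_boundary[OF wf(2) that(2)]])
  then have "lin (type_indicator i j) (Z \<phi> (Juxtapose s t) d) =
      (\<Sum>a\<le>d. lin (type_indicator i j) (Z \<phi> s a) * lin (type_indicator i j) (Z \<phi> t (d - a)))"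
    unfolding Z.simps by (intro lin_sprod)
  then show ?case
    by (simp only: Juxtapose.IH(1)[OF wf(1)] Juxtapose.IH(2)[OF wf(2)] binomial_divided_powers
        crossing_sum.simps add_divide_distrib)
qed

section \<open>Isomorphism classes of codes\<close>

lemma rotate_inverse: "\<exists>k. rotate k (rotate r v) = v"
proof
  \<comment> \<open>Together with \<open>r\<close> this makes a multiple of the length, also when
    \<open>r\<close> exceeds the length and \<open>length v - r\<close> would be truncated.\<close>
  show "rotate (r * length v - r) (rotate r v) = v"
  proof (cases "length v")
    case (Suc l)
    then have "r * length v - r + r = r * length v" by simp
    then have "rotate (r * length v - r) (rotate r v) = rotate (r * length v) v"
      by (simp only: rotate_rotate)
    also have "\<dots> = v"
      by (simp add: rotate_conv_mod[of "r * length v"])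
    finally show ?thesis .
  qed simp
qed

lemma same_up_to_base_point_refl: "same_up_to_base_point x x"
  by (cases "(x, x)" rule: same_up_to_base_point.cases) (auto intro: exI[of _ 0])

lemma same_up_to_base_point_sym: "same_up_to_base_point x y \<Longrightarrow> same_up_to_base_point y x"
  by (cases "(x, y)" rule: same_up_to_base_point.cases) (auto, metis rotate_inverse)

lemma same_up_to_base_point_trans:
  "same_up_to_base_point x y \<Longrightarrow> same_up_to_base_point y z \<Longrightarrow> same_up_to_base_point x z"
  by (cases "(x, y)" rule: same_up_to_base_point.cases; cases z) (auto simp: rotate_rotate)

lemma same_up_to_base_point_map:
  "same_up_to_base_point x y \<Longrightarrow>
    same_up_to_base_point (fst x, map g (snd x)) (fst y, map g (snd y))"
  by (cases "(x, y)" rule: same_up_to_base_point.cases) (auto simp: rotate_map)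

lemma list_all2_same_refl: "list_all2 same_up_to_base_point D D"
  by (simp add: list_all2_refl same_up_to_base_point_refl)

lemma list_all2_same_sym:
  "list_all2 same_up_to_base_point D E \<Longrightarrow> list_all2 same_up_to_base_point E D"
  by (simp add: list_all2_conv_all_nth same_up_to_base_point_sym)

text \<open>\<open>diagram_iso\<close> renames, then reorders, then moves base points. Inverting or
  composing isomorphisms requires exchanging the last two operations.\<close>

lemma list_all2_same_reorder:
  assumes "list_all2 same_up_to_base_point D E" "mset E' = mset E"
  shows "\<exists>D'. list_all2 same_up_to_base_point D' E' \<and> mset D' = mset D"
  using list_all2_reorder_left_invariance[OF list_all2_same_sym[OF assms(1)] assms(2)]
    list_all2_same_sym by blast

lemma list_all2_same_trans:
  "list_all2 same_up_to_base_point D E \<Longrightarrow> list_all2 same_up_to_base_point E F \<Longrightarrow>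
    list_all2 same_up_to_base_point D F"
  by (rule list_all2_trans[of same_up_to_base_point same_up_to_base_point])
    (blast intro: same_up_to_base_point_trans)

lemma list_all2_same_map:
  "list_all2 same_up_to_base_point D E \<Longrightarrow>
    list_all2 same_up_to_base_point (map_words (map g) D) (map_words (map g) E)"
  by (simp add: list_all2_conv_all_nth map_words_def case_prod_beta same_up_to_base_point_map)

lemma mset_map_words_cong: "mset D = mset E \<Longrightarrow> mset (map_words h D) = mset (map_words h E)"
  by (simp add: map_words_def)

lemma map_words_map_words: "map_words (map g) (map_words (map f) D) = map_words (map (g \<circ> f)) D"
  by (simp add: map_words_def case_prod_beta)

lemma map_words_map_id:
  assumes "\<And>x. x \<in> set (letters D) \<Longrightarrow> h x = x"
  shows "map_words (map h) D = D"
  unfolding map_words_def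
proof (rule map_idI)
  fix x assume "x \<in> set D"
  then have "set (snd x) \<subseteq> set (letters D)" by (force simp: letters_def)
  then have "map h (snd x) = snd x"
    using assms by (intro map_idI) blast
  then show "(case x of (s, w) \<Rightarrow> (s, map h w)) = x"
    by (simp add: case_prod_beta)
qed

lemma set_letters_map_words: "set (letters (map_words (map f) D)) = f ` set (letters D)"
  unfolding set_letters occurrences_map_words_map fst_set_map_prod ..

lemma set_letters_iso:
  assumes "mset D' = mset (map_words (map f) D)" "list_all2 same_up_to_base_point D' E"
  shows "set (letters E) = f ` set (letters D)"
  using occurrences_mset_cong[OF assms(1)] same_up_to_base_point_invariants(2)[OF assms(2)]
    set_letters_map_words[of f D] by (simp only: set_letters)

lemma diagram_iso_map_words:
  "inj_on f (set (letters D)) \<Longrightarrow> diagram_iso D (map_words (map f) D)"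
  unfolding diagram_iso_def using list_all2_same_refl by blast

lemma diagram_iso_refl: "diagram_iso D D"
  using diagram_iso_map_words[of id D] map_words_map_id[of D id] by simp

lemma diagram_iso_sym:
  assumes "diagram_iso D E"
  shows "diagram_iso E D"
proof -
  obtain f D' where f: "inj_on f (set (letters D))" "mset D' = mset (map_words (map f) D)"
      "list_all2 same_up_to_base_point D' E"
    using assms by (auto simp: diagram_iso_def)
  define g where "g = inv_into (set (letters D)) f"
  have "map_words (map (g \<circ> f)) D = D"
    using f(1) by (intro map_words_map_id) (simp add: g_def)
  then have 1: "mset D = mset (map_words (map g) D')"
    using mset_map_words_cong[OF f(2), of "map g"] by (simp only: map_words_map_words)
  have "list_all2 same_up_to_base_point (map_words (map g) E) (map_words (map g) D')"
    by (rule list_all2_same_map[OF list_all2_same_sym[OF f(3)]])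
  from list_all2_same_reorder[OF this 1] obtain E' where
    "list_all2 same_up_to_base_point E' D" "mset E' = mset (map_words (map g) E)" by blast
  moreover have "inj_on g (set (letters E))"
    unfolding set_letters_iso[OF f(2,3)] g_def by (rule inj_on_inv_into) simp
  ultimately show ?thesis unfolding diagram_iso_def by blast
qed

lemma diagram_iso_trans:
  assumes "diagram_iso D E" "diagram_iso E F"
  shows "diagram_iso D F"
proof -
  obtain f D' where f: "inj_on f (set (letters D))" "mset D' = mset (map_words (map f) D)"
      "list_all2 same_up_to_base_point D' E"
    using assms(1) by (auto simp: diagram_iso_def)
  obtain g E' where g: "inj_on g (set (letters E))" "mset E' = mset (map_words (map g) E)"
      "list_all2 same_up_to_base_point E' F"
    using assms(2) by (auto simp: diagram_iso_def)
  from list_all2_same_reorder[OF list_all2_same_map[OF f(3)] g(2)] obtain D''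
    where D'': "list_all2 same_up_to_base_point D'' E'" "mset D'' = mset (map_words (map g) D')"
    by blast
  have "mset D'' = mset (map_words (map (g \<circ> f)) D)"
    using D''(2) mset_map_words_cong[OF f(2), of "map g"] by (simp only: map_words_map_words)
  moreover have "list_all2 same_up_to_base_point D'' F"
    using D''(1) g(3) by (rule list_all2_same_trans)
  moreover have "inj_on (g \<circ> f) (set (letters D))"
    using f(1) g(1) unfolding set_letters_iso[OF f(2,3)] by (rule comp_inj_on)
  ultimately show ?thesis unfolding diagram_iso_def by blast
qed

section \<open>Mixed diagrams as isomorphism classes, and the sum of their coefficients\<close>

abbreviation iso_rel :: "(diagram \<times> diagram) set" where
  "iso_rel \<equiv> {(D, E). diagram_iso D E}"

lemma equiv_iso_rel: "equiv UNIV iso_rel"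
  by (rule equivI) (auto simp: refl_on_def sym_def trans_def
      intro: diagram_iso_refl diagram_iso_sym diagram_iso_trans)

definition mixed_codes :: "nat \<Rightarrow> nat \<Rightarrow> nat \<Rightarrow> nat \<Rightarrow> diagram set" where
  "mixed_codes m i j n =
    {D \<in> codes_on_circles m. degree D = n \<and> only_type i j (occurrences D)}"

lemma mixed_indicator_codes:
  "mixed_indicator (\<lambda>M. M = mset (map Circle [1..<Suc m])) i j n D =
    of_bool (D \<in> mixed_codes m i j n)"
  using is_diagram_if_only_type[of i j D]
  unfolding mixed_indicator_def mixed_codes_def codes_on_circles_def mem_Collect_eq
  by (intro arg_cong[where f = of_bool]) blast

lemma mixed_codes_iso:
  assumes "diagram_iso D E"
  shows "D \<in> mixed_codes m i j n \<longleftrightarrow> E \<in> mixed_codes m i j n"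
  using mixed_indicator_iso[OF assms, of "\<lambda>M. M = mset (map Circle [1..<Suc m])" i j n]
  unfolding mixed_indicator_codes of_bool_eq_iff by blast

lemma class_degree_eq: "class_degree (iso_rel `` {D}) = degree D"
proof -
  have "degree ` (iso_rel `` {D}) = {degree D}"
  proof (intro equalityI subsetI)
    fix d assume "d \<in> degree ` (iso_rel `` {D})"
    then show "d \<in> {degree D}" by (auto dest: degree_iso)
  next
    fix d assume "d \<in> {degree D}"
    then show "d \<in> degree ` (iso_rel `` {D})" using diagram_iso_refl[of D] by blast
  qed
  then show ?thesis by (simp add: class_degree_def)
qed

text \<open>Chord types and degree are invariant under isomorphism, so one code decides for its
  whole class.\<close>

lemma mixed_diagrams_eq: "mixed_diagrams m i j n = mixed_codes m i j n // iso_rel"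
proof (intro equalityI subsetI)
  fix K assume K: "K \<in> mixed_diagrams m i j n"
  then obtain D where D: "D \<in> codes_on_circles m" "K = iso_rel `` {D}"
    by (auto simp: mixed_diagrams_def chord_diagrams_def elim: quotientE)
  have "D \<in> K" using diagram_iso_refl[of D] by (simp add: D(2))
  then have "only_type i j (occurrences D)"
    using K by (simp add: mixed_diagrams_def only_type_def set_letters chord_type_occurrences)
  moreover have "degree D = n"
    using K class_degree_eq[of D] by (simp add: mixed_diagrams_def D(2))
  ultimately show "K \<in> mixed_codes m i j n // iso_rel"
    unfolding D(2) using D(1) by (intro quotientI) (simp add: mixed_codes_def)
next
  fix K assume "K \<in> mixed_codes m i j n // iso_rel"
  then obtain D where D: "D \<in> mixed_codes m i j n" "K = iso_rel `` {D}"
    by (rule quotientE)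
  have "only_type i j (occurrences E)" if "E \<in> K" for E
    using that D mixed_codes_iso[of D E m i j n] by (simp add: mixed_codes_def)
  then have "\<forall>E\<in>K. \<forall>x\<in>set (letters E). chord_type E x = {#i, j#}"
    by (simp add: only_type_def set_letters chord_type_occurrences)
  moreover have "K \<in> chord_diagrams m"
    unfolding D(2) chord_diagrams_def using D(1) by (intro quotientI) (simp add: mixed_codes_def)
  moreover have "class_degree K = n"
    unfolding D(2) class_degree_eq using D(1) by (simp add: mixed_codes_def)
  ultimately show "K \<in> mixed_diagrams m i j n"
    by (simp add: mixed_diagrams_def)
qed

lemma length_letters_diagram:
  assumes "is_diagram D"
  shows "length (letters D) = 2 * degree D"
proof -
  have "length (letters D) = (\<Sum>x\<in>set (letters D). count_list (letters D) x)"
    by (rule sum_count_set[symmetric]) auto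
  also have "\<dots> = 2 * degree D"
    using assms by (simp add: is_diagram_def degree_def)
  finally show ?thesis .
qed

text \<open>A sum over an infinite set would be 0.\<close>

lemma finite_mixed_diagrams: "finite (mixed_diagrams m i j n)"
proof -
  let ?W = "{w. set w \<subseteq> {..<n} \<and> length w \<le> 2 * n}"
  let ?C = "{D. set D \<subseteq> (Circle ` {1..<Suc m}) \<times> ?W \<and> length D = m}"
  have "mixed_codes m i j n // iso_rel \<subseteq> (\<lambda>D. iso_rel `` {D}) ` ?C"
  proof
    fix K assume "K \<in> mixed_codes m i j n // iso_rel"
    then obtain D where D: "D \<in> mixed_codes m i j n" "K = iso_rel `` {D}"
      by (rule quotientE)
    have "card (set (letters D)) = n"
      using D(1) by (simp add: mixed_codes_def degree_def)
    \<comment> \<open>Naming the chords by \<open>{..<n}\<close> puts a representative of each class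
      into a finite set: \<open>m\<close> words over \<open>n\<close> letters, together of length
      \<open>2 * n\<close>.\<close>
    then obtain f where f: "inj_on f (set (letters D))" "f ` set (letters D) = {..<n}"
      using ex_bij_betw_finite_nat[of "set (letters D)"]
      by (auto simp: bij_betw_def atLeast0LessThan)
    define E where "E = map_words (map f) D"
    have iso: "diagram_iso D E"
      unfolding E_def using f(1) by (rule diagram_iso_map_words)
    then have E: "E \<in> codes_on_circles m" "degree E = n"
      using D(1) mixed_codes_iso[OF iso, of m i j n] by (simp_all add: mixed_codes_def)
    have len: "length (letters E) = 2 * n"
      using length_letters_diagram[of E] E by (simp add: codes_on_circles_def)
    have comps: "mset (map fst E) = mset (map Circle [1..<Suc m])"
      using E(1) by (simp add: codes_on_circles_def)
    then have "size (mset (map fst E)) = size (mset (map Circle [1..<Suc m]))" by (rule arg_cong)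
    then have "length E = m" by simp
    moreover have "(s, w) \<in> Circle ` {1..<Suc m} \<times> ?W" if "(s, w) \<in> set E" for s w
    proof -
      have "s \<in> set (map fst E)" using that by force
      then have "s \<in> set (map Circle [1..<Suc m])" using mset_eq_setD[OF comps] by blast
      then have "s \<in> Circle ` {1..<Suc m}" unfolding set_map set_upt .
      moreover have "set w \<subseteq> set (letters E)"
        using that by (force simp: letters_def)
      then have "set w \<subseteq> {..<n}"
        using f(2) by (simp only: E_def set_letters_map_words)
      moreover have "length w \<in> set (map (length \<circ> snd) E)"
        using that by force
      then have "length w \<le> 2 * n"
        using member_le_sum_list[of "length w" "map (length \<circ> snd) E"] len
        by (simp add: letters_def length_concat)
      ultimately show ?thesis by simp
    qed
    ultimately have "E \<in> ?C" by auto
    moreover have "K = iso_rel `` {E}"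
      using equiv_class_eq[OF equiv_iso_rel, of D E] iso D(2) by simp
    ultimately show "K \<in> (\<lambda>D. iso_rel `` {D}) ` ?C" by blast
  qed
  moreover have "finite ?C"
    by (intro finite_lists_length_eq finite_cartesian_product finite_imageI finite_lists_length_le) auto
  ultimately show ?thesis
    unfolding mixed_diagrams_eq by (rule finite_subset[OF _ finite_imageI])
qed

text \<open>The classes are disjoint and their union is \<open>mixed_codes\<close>, so summing over
  classes and then over codes is summing over the keys that are mixed codes. The sum of individually
  ill-defined coefficients thus becomes one linear functional.\<close>

lemma sum_coefficients:
  "(\<Sum>K\<in>mixed_diagrams m i j n. coefficient K A) =
    lin (mixed_indicator (\<lambda>M. M = mset (map Circle [1..<Suc m])) i j n) (A n)"
proof -
  let ?k = "Poly_Mapping.keys (A n)" and ?S = "mixed_codes m i j n"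
  have "coefficient K A = (\<Sum>D\<in>K \<inter> ?k. Poly_Mapping.lookup (A n) D)"
    if "K \<in> mixed_diagrams m i j n" for K
    using that by (simp add: coefficient_def mixed_diagrams_def)
  then have "(\<Sum>K\<in>mixed_diagrams m i j n. coefficient K A) =
      (\<Sum>K\<in>mixed_diagrams m i j n. \<Sum>D\<in>K \<inter> ?k. Poly_Mapping.lookup (A n) D)"
    by simp
  also have "\<dots> = (\<Sum>D\<in>(\<Union>K\<in>mixed_diagrams m i j n. K \<inter> ?k). Poly_Mapping.lookup (A n) D)"
  proof (rule sum.UNION_disjoint[symmetric])
    show "\<forall>K\<in>mixed_diagrams m i j n. \<forall>K'\<in>mixed_diagrams m i j n. K \<noteq> K' \<longrightarrow>
        (K \<inter> ?k) \<inter> (K' \<inter> ?k) = {}"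
    proof (intro ballI impI)
      fix K K' assume "K \<in> mixed_diagrams m i j n" "K' \<in> mixed_diagrams m i j n" "K \<noteq> K'"
      moreover have "?S // iso_rel \<subseteq> UNIV // iso_rel" by (auto simp: quotient_def)
      ultimately have "K \<inter> K' = {}"
        using quotient_disj[OF equiv_iso_rel, of K K'] by (auto simp: mixed_diagrams_eq)
      then show "(K \<inter> ?k) \<inter> (K' \<inter> ?k) = {}" by blast
    qed
  qed (auto simp: finite_mixed_diagrams)
  also have "(\<Union>K\<in>mixed_diagrams m i j n. K \<inter> ?k) = {D \<in> ?k. D \<in> ?S}"
  proof (intro equalityI subsetI)
    fix D assume "D \<in> (\<Union>K\<in>mixed_diagrams m i j n. K \<inter> ?k)"
    then obtain E where "D \<in> ?k" "E \<in> ?S" "diagram_iso E D"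
      by (auto simp: mixed_diagrams_eq quotient_def)
    then show "D \<in> {D \<in> ?k. D \<in> ?S}"
      using mixed_codes_iso[of E D] by simp
  next
    fix D assume D: "D \<in> {D \<in> ?k. D \<in> ?S}"
    then have "iso_rel `` {D} \<in> mixed_diagrams m i j n"
      unfolding mixed_diagrams_eq by (intro quotientI) simp
    moreover have "D \<in> iso_rel `` {D} \<inter> ?k"
      using D diagram_iso_refl[of D] by simp
    ultimately show "D \<in> (\<Union>K\<in>mixed_diagrams m i j n. K \<inter> ?k)" by (rule UN_I)
  qed
  also have "(\<Sum>D\<in>\<dots>. Poly_Mapping.lookup (A n) D) =
      (\<Sum>D\<in>?k. if D \<in> ?S then Poly_Mapping.lookup (A n) D else 0)"
    by (rule sum.inter_filter) simp
  also have "\<dots> = lin (mixed_indicator (\<lambda>M. M = mset (map Circle [1..<Suc m])) i j n) (A n)"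
    unfolding lin_def mixed_indicator_codes by (intro sum.cong) auto
  finally show ?thesis .
qed

theorem mainTheorem2:
  fixes m n i j :: nat and L :: qtangle and \<Phi> :: nc_series and A :: "diagram series"
  assumes "m \<ge> 2" and "presents_link m L"
    and "1 \<le> i" and "i < j" and "j \<le> m" and "n \<ge> 1"
    and "drinfeld_associator \<Phi>"
    and "A \<in> kontsevich \<Phi> L"
  shows "1 / fact n * linking_number i j L ^ n =
         (\<Sum>D\<in>mixed_diagrams m i j n. coefficient D A)"
proof -
  let ?P = "\<lambda>M. M = mset (map Circle [1..<Suc m])"
  have L: "well_formed L" "mset (map fst (skeleton L)) = mset (map Circle [1..<Suc m])"
    using assms(2) unfolding presents_link_def by blast+
  have \<Phi>: "group_like \<Phi>" "pentagon \<Phi>"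
    using assms(7) unfolding drinfeld_associator_def by blast+
  have ij: "i \<noteq> j" using assms(4) by simp
  have "(\<Sum>D\<in>mixed_diagrams m i j n. coefficient D A) = lin (mixed_indicator ?P i j n) (A n)"
    by (rule sum_coefficients)
  also have "\<dots> = lin (mixed_indicator ?P i j n) (Z \<Phi> L n)"
    by (rule lin_equal_mod_4T) (use assms(8) in \<open>simp add: kontsevich_def\<close>)
  also have "\<dots> = lin (type_indicator i j) (Z \<Phi> L n)"
  proof (rule lin_mixed_eq_type_indicator)
    fix D assume "D \<in> Poly_Mapping.keys (Z \<Phi> L n)"
    note keys = keys_Z[OF L(1) ij this]
    show "mset (map fst D) = mset (map Circle [1..<Suc m])"
      using keys L(2) by simp
    show "degree D = n" if "only_type i j (occurrences D)"
      using keys that by blast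
  qed
  also have "\<dots> = linking_number i j L ^ n / fact n"
    unfolding lin_Z[OF L(1) ij \<Phi>] linking_number_def ..
  finally show ?thesis by simp
qed

end
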